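(* For every integer $p\ge1$ and every real $\alpha\ge1$, the Simons cone $C(S^p\times S^p)$ is $|x|^\alpha$-minimizing.
   Context: The Simons cone is $\mathcal{C}=C(S^p\times S^p)=\{(x_0,\dots,x_{2p+1})\in\mathbb{R}^{2p+2}: x_0^2+\cdots+x_p^2=x_{p+1}^2+\cdots+x_{2p+1}^2\}$, of dimension $k=2p+1$. Let $\Sigma$ be its intersection with the unit sphere and $\mathcal{C}_1$ its intersection with the unit ball, an orientable surface with $\partial\mathcal{C}_1=\Sigma$, regarded as a rectifiable current. With $f(x)=|x|^\alpha$ and $\mathcal{E}_f(S)=\int_Sf\,d\mathcal{H}_k$ the $f$-weighted area (weighted mass) of a $k$-dimensional rectifiable current $S$, the cone is $|x|^\alpha$-minimizing if $\mathcal{E}_f(\mathcal{C}_1)\le\mathcal{E}_f(S)$ for every rectifiable current $S$ with $\partial S=\Sigma$. *)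

theory Defs
  imports "HOL-Analysis.Analysis"
begin

section \<open>Hausdorff measure\<close>

text \<open>Normalised so that the \<open>k\<close>-dimensional Hausdorff measure agrees with Lebesgue measure on
  \<open>k\<close>-planes. Empty covering sets must contribute \<open>0\<close> also when \<open>k = 0\<close>, where \<open>0 ^ 0 = 1\<close>.
  The library's \<^const>\<open>diameter\<close> is unspecified on unbounded sets, hence the boundedness
  condition.\<close>

definition hausdorff_size :: "nat \<Rightarrow> 'a::euclidean_space set \<Rightarrow> ennreal" where
  "hausdorff_size k A =
     (if A = {} then 0 else ennreal (unit_ball_vol (real k) * (diameter A / 2) ^ k))"

definition hausdorff_covers :: "real \<Rightarrow> 'a::euclidean_space set \<Rightarrow> (nat \<Rightarrow> 'a set) set" where
  "hausdorff_covers \<delta> A =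
     {C. A \<subseteq> (\<Union>i. C i) \<and> (\<forall>i. bounded (C i) \<and> diameter (C i) \<le> \<delta>)}"

definition hausdorff_outer :: "nat \<Rightarrow> 'a::euclidean_space set \<Rightarrow> ennreal" where
  "hausdorff_outer k A =
     (SUP \<delta>\<in>{0<..}. INF C\<in>hausdorff_covers \<delta> A. \<Sum>i. hausdorff_size k (C i))"

text \<open>The measurable sets are the Caratheodory measurable ones, so the measure is complete.\<close>

definition hausdorff :: "nat \<Rightarrow> 'a::euclidean_space measure" where
  "hausdorff k =
     measure_of UNIV (lambda_system UNIV UNIV (hausdorff_outer k)) (hausdorff_outer k)"

text \<open>\<^const>\<open>measure_of\<close> silently yields the zero measure unless it is given a measure; the
  following lemmas show that this does not happen here.\<close>

lemma hausdorff_outer_mono: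
  assumes "A \<subseteq> B"
  shows "hausdorff_outer k A \<le> hausdorff_outer k B"
  unfolding hausdorff_outer_def
  by (intro SUP_mono' INF_superset_mono) (use assms in \<open>auto simp: hausdorff_covers_def\<close>)

lemma hausdorff_outer_empty: "hausdorff_outer k {} = 0"
proof -
  have "(INF C\<in>hausdorff_covers \<delta> ({} :: 'a set). \<Sum>i. hausdorff_size k (C i)) = 0"
    if "\<delta> > 0" for \<delta>
  proof -
    have "(\<lambda>_. {}) \<in> hausdorff_covers \<delta> ({} :: 'a set)"
      using that by (auto simp: hausdorff_covers_def)
    then have "(INF C\<in>hausdorff_covers \<delta> ({} :: 'a set). \<Sum>i. hausdorff_size k (C i))
        \<le> (\<Sum>i::nat. hausdorff_size k ({} :: 'a set))"
      by (rule INF_lower)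
    then show ?thesis
      by (simp add: hausdorff_size_def)
  qed
  then show ?thesis
    by (simp add: hausdorff_outer_def)
qed

lemma hausdorff_outer_countably_subadditive:
  "hausdorff_outer k (\<Union>i. A i) \<le> (\<Sum>i. hausdorff_outer k (A i))"
proof -
  have "(INF C\<in>hausdorff_covers \<delta> (\<Union>i. A i). \<Sum>j. hausdorff_size k (C j))
      \<le> (\<Sum>i. hausdorff_outer k (A i))" if "\<delta> > 0" for \<delta>
  proof (rule ennreal_le_epsilon)
    fix e :: real
    assume fin: "(\<Sum>i. hausdorff_outer k (A i)) < top" and e: "0 < e"
    have "\<exists>C\<in>hausdorff_covers \<delta> (A i). (\<Sum>j. hausdorff_size k (C j))
        \<le> hausdorff_outer k (A i) + ennreal (e * (1 / 2) ^ Suc i)" for i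
    proof -
      have "hausdorff_outer k (A i) < top"
        using fin by (rule ennreal_suminf_lessD)
      moreover have "(INF C\<in>hausdorff_covers \<delta> (A i). \<Sum>j. hausdorff_size k (C j))
          \<le> hausdorff_outer k (A i)"
        unfolding hausdorff_outer_def by (rule SUP_upper) (simp add: that)
      moreover have "hausdorff_outer k (A i)
          < hausdorff_outer k (A i) + ennreal (e * (1 / 2) ^ Suc i)"
      proof -
        have "0 < ennreal (e * (1 / 2) ^ Suc i)"
          using e by (simp add: ennreal_zero_less_mult_iff)
        then show ?thesis
          using ennreal_add_left_cancel_less[of "hausdorff_outer k (A i)" 0]
            \<open>hausdorff_outer k (A i) < top\<close>
          by (simp only: add_0_right infinity_ennreal_def less_top simp_thms)
      qed
      ultimately have "(INF C\<in>hausdorff_covers \<delta> (A i). \<Sum>j. hausdorff_size k (C j))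
          < hausdorff_outer k (A i) + ennreal (e * (1 / 2) ^ Suc i)"
        by (simp only: order.strict_trans1)
      then show ?thesis
        unfolding INF_less_iff by (auto intro: less_imp_le)
    qed
    then obtain C where C: "\<And>i. C i \<in> hausdorff_covers \<delta> (A i)"
      and le: "\<And>i. (\<Sum>j. hausdorff_size k (C i j))
        \<le> hausdorff_outer k (A i) + ennreal (e * (1 / 2) ^ Suc i)"
      by metis
    define D where "D n = (case prod_decode n of (i, j) \<Rightarrow> C i j)" for n
    have D: "D (prod_encode (i, j)) = C i j" for i j
      by (simp add: D_def)
    have "(\<Union>i. A i) \<subseteq> (\<Union>n. D n)"
    proof
      fix x
      assume "x \<in> (\<Union>i. A i)"
      then obtain i where "x \<in> A i"
        by blast
      then obtain j where "x \<in> C i j"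
        using C[of i] unfolding hausdorff_covers_def by blast
      then show "x \<in> (\<Union>n. D n)"
        using D[of i j] by blast
    qed
    moreover have "bounded (D n) \<and> diameter (D n) \<le> \<delta>" for n
    proof -
      obtain i j where "prod_decode n = (i, j)"
        by fastforce
      then show ?thesis
        using C[of i] by (simp add: D_def hausdorff_covers_def)
    qed
    ultimately have "D \<in> hausdorff_covers \<delta> (\<Union>i. A i)"
      unfolding hausdorff_covers_def by blast
    then have "(INF C\<in>hausdorff_covers \<delta> (\<Union>i. A i). \<Sum>j. hausdorff_size k (C j))
        \<le> (\<Sum>n. hausdorff_size k (D n))"
      by (rule INF_lower)
    also have "\<dots> = (\<Sum>i. \<Sum>j. hausdorff_size k (C i j))"
    proof -
      have *: "(\<lambda>n. hausdorff_size k (D n)) =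
          (\<lambda>n. (\<lambda>(i, j). hausdorff_size k (C i j)) (prod_decode n))"
        by (simp add: fun_eq_iff D_def split_beta)
      show ?thesis
        unfolding * by (rule suminf_ennreal_2dimen) simp
    qed
    also have "\<dots> \<le> (\<Sum>i. hausdorff_outer k (A i) + ennreal (e * (1 / 2) ^ Suc i))"
      by (intro suminf_le le) auto
    also have "\<dots> = (\<Sum>i. hausdorff_outer k (A i)) + (\<Sum>i. ennreal (e * (1 / 2) ^ Suc i))"
      by (intro suminf_add[symmetric]) auto
    also have "(\<Sum>i. ennreal (e * (1 / 2) ^ Suc i)) = ennreal e"
    proof (rule suminf_ennreal_eq)
      show "(\<lambda>i. e * (1 / 2) ^ Suc i) sums e"
        using sums_mult[OF power_half_series, of e] by simp
    qed (use e in simp)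
    finally show "(INF C\<in>hausdorff_covers \<delta> (\<Union>i. A i). \<Sum>j. hausdorff_size k (C j))
        \<le> (\<Sum>i. hausdorff_outer k (A i)) + ennreal e" .
  qed
  then show ?thesis
    unfolding hausdorff_outer_def[of k "\<Union>i. A i"] by (intro SUP_least) simp
qed

lemma
  shows space_hausdorff: "space (hausdorff k :: 'a::euclidean_space measure) = UNIV"
    and sets_hausdorff: "sets (hausdorff k :: 'a measure) =
      lambda_system UNIV UNIV (hausdorff_outer k)"
    and emeasure_hausdorff:
      "(A :: 'a set) \<in> sets (hausdorff k) \<Longrightarrow> emeasure (hausdorff k) A = hausdorff_outer k A"
proof -
  interpret sigma_algebra UNIV "UNIV :: 'a set set"
    using sigma_algebra_Pow[of "UNIV :: 'a set"] by simp
  have "outer_measure_space UNIV (hausdorff_outer k :: 'a set \<Rightarrow> ennreal)"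
    by (auto simp: outer_measure_space_def positive_def increasing_def countably_subadditive_def
        hausdorff_outer_empty hausdorff_outer_mono hausdorff_outer_countably_subadditive)
  then have ms: "measure_space (UNIV :: 'a set)
      (lambda_system UNIV UNIV (hausdorff_outer k)) (hausdorff_outer k)"
    by (rule caratheodory_lemma)
  show "space (hausdorff k) = (UNIV :: 'a set)"
    by (simp add: hausdorff_def space_measure_of_conv)
  show *: "sets (hausdorff k :: 'a measure) = lambda_system UNIV UNIV (hausdorff_outer k)"
    using ms unfolding hausdorff_def measure_space_def
    by (auto simp: sets_measure_of_conv sigma_algebra.sigma_sets_eq)
  show "emeasure (hausdorff k) A = hausdorff_outer k A" if "A \<in> sets (hausdorff k)"
    for A :: "'a set"
    by (rule emeasure_measure_of[OF hausdorff_def])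
      (use ms that * in \<open>simp_all add: measure_space_def\<close>)
qed


section \<open>Differential forms\<close>

text \<open>A \<open>k\<close>-covector is an alternating multilinear function of \<open>k\<close> vectors, the arguments being
  passed as a list; its values on lists of any other length are irrelevant and unconstrained.\<close>

definition covector :: "nat \<Rightarrow> ('a::euclidean_space list \<Rightarrow> real) \<Rightarrow> bool" where
  "covector k \<phi> \<longleftrightarrow>
     (\<forall>v i. length v = k \<longrightarrow> i < k \<longrightarrow> linear (\<lambda>w. \<phi> (v[i := w]))) \<and>
     (\<forall>v i j. length v = k \<longrightarrow> i < j \<longrightarrow> j < k \<longrightarrow> v ! i = v ! j \<longrightarrow> \<phi> v = 0)"

primrec C_n :: "nat \<Rightarrow> ('a::euclidean_space \<Rightarrow> real) \<Rightarrow> bool" where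
  "C_n 0 f \<longleftrightarrow> continuous_on UNIV f"
| "C_n (Suc n) f \<longleftrightarrow>
     (\<forall>x. f differentiable at x) \<and> (\<forall>v. C_n n (\<lambda>x. frechet_derivative f (at x) v))"

type_synonym 'a form = "'a \<Rightarrow> 'a list \<Rightarrow> real"

definition test_form :: "nat \<Rightarrow> 'a::euclidean_space form \<Rightarrow> bool" where
  "test_form k \<omega> \<longleftrightarrow>
     (\<forall>x. covector k (\<omega> x)) \<and>
     (\<forall>v n. length v = k \<longrightarrow> C_n n (\<lambda>x. \<omega> x v)) \<and>
     (\<exists>K. compact K \<and> (\<forall>x v. x \<notin> K \<longrightarrow> length v = k \<longrightarrow> \<omega> x v = 0))"

text \<open>The alternating sum over \<open>i\<close> of the derivatives in the direction of the \<open>i\<close>-th vector of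
  the form evaluated at the remaining vectors.\<close>

definition ext_deriv :: "'a::euclidean_space form \<Rightarrow> 'a form" where
  "ext_deriv \<omega> x v =
     (\<Sum>i<length v. (-1) ^ i *
        frechet_derivative (\<lambda>y. \<omega> y (take i v @ drop (Suc i) v)) (at x) (v ! i))"


section \<open>Tangent cones and rectifiable sets\<close>

definition tangent_cone :: "'a::euclidean_space set \<Rightarrow> 'a \<Rightarrow> 'a set" where
  "tangent_cone S a =
     {v. \<forall>\<epsilon>>0. \<exists>x\<in>S. \<exists>r>0. norm (x - a) < \<epsilon> \<and> norm (r *\<^sub>R (x - a) - v) < \<epsilon>}"

text \<open>Federer's approximate tangent cone of \<open>E\<close> at \<open>a\<close>: the intersection of the tangent cones of
  all sets \<open>S\<close> such that \<open>E - S\<close> has \<open>k\<close>-dimensional density zero at \<open>a\<close>.\<close>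

definition approx_tangent_cone :: "nat \<Rightarrow> 'a::euclidean_space set \<Rightarrow> 'a \<Rightarrow> 'a set" where
  "approx_tangent_cone k E a =
     \<Inter> {tangent_cone S a | S.
          ((\<lambda>r. hausdorff_outer k ((E - S) \<inter> cball a r) / ennreal (unit_ball_vol (real k) * r ^ k))
             \<longlongrightarrow> 0) (at_right 0)}"

text \<open>A \<open>k\<close>-dimensional linear subspace \<open>V\<close> of the ambient space serves as the Euclidean space on
  which the Lipschitz parametrisations are defined.\<close>

definition countably_rectifiable :: "nat \<Rightarrow> 'a::euclidean_space set \<Rightarrow> bool" where
  "countably_rectifiable k E \<longleftrightarrow>
     (\<exists>V (g :: nat \<Rightarrow> 'a \<Rightarrow> 'a). subspace V \<and> dim V = k \<and>
        (\<forall>i. \<exists>L. L-lipschitz_on V (g i)) \<and> hausdorff_outer k (E - (\<Union>i. g i ` V)) = 0)"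

definition orthonormal_frame :: "nat \<Rightarrow> 'a::euclidean_space list \<Rightarrow> bool" where
  "orthonormal_frame k v \<longleftrightarrow>
     length v = k \<and> (\<forall>i<k. \<forall>j<k. v ! i \<bullet> v ! j = (if i = j then 1 else 0))"


section \<open>Rectifiable currents\<close>

text \<open>A \<open>k\<close>-dimensional rectifiable current is given by a carrier, a positive integer multiplicity
  and an orientation. The orienting simple unit \<open>k\<close>-vector at a point is represented by an
  orthonormal list of vectors whose wedge product it is. As different lists may have the same
  wedge product, measurability and continuity of the \<open>k\<close>-vector field are expressed by pairing it
  with the constant covectors.\<close>

record 'a rect_data =
  carr :: "'a set"
  mult :: "'a \<Rightarrow> nat"
  orient :: "'a \<Rightarrow> 'a list"

text \<open>Rectifiable currents have compact support, whence \<^term>\<open>bounded (carr S)\<close>.\<close>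

definition rectifiable_current :: "nat \<Rightarrow> 'a::euclidean_space rect_data \<Rightarrow> bool" where
  "rectifiable_current k S \<longleftrightarrow>
     carr S \<in> sets (hausdorff k) \<and> bounded (carr S) \<and> countably_rectifiable k (carr S) \<and>
     set_borel_measurable (hausdorff k) (carr S) (\<lambda>x. real (mult S x)) \<and>
     (\<forall>x\<in>carr S. mult S x \<ge> 1) \<and>
     (\<integral>\<^sup>+x\<in>carr S. ennreal (real (mult S x)) \<partial>hausdorff k) < \<infinity> \<and>
     (\<forall>x\<in>carr S. orthonormal_frame k (orient S x)) \<and>
     (\<forall>\<phi>. covector k \<phi> \<longrightarrow>
        set_borel_measurable (hausdorff k) (carr S) (\<lambda>x. \<phi> (orient S x))) \<and>
     (AE x in hausdorff k. x \<in> carr S \<longrightarrow>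
        span (set (orient S x)) = approx_tangent_cone k (carr S) x)"

definition current :: "nat \<Rightarrow> 'a::euclidean_space rect_data \<Rightarrow> 'a form \<Rightarrow> real" where
  "current k S \<omega> = (LINT x:carr S|hausdorff k. real (mult S x) * \<omega> x (orient S x))"

definition boundary :: "('a::euclidean_space form \<Rightarrow> real) \<Rightarrow> 'a form \<Rightarrow> real" where
  "boundary T \<phi> = T (ext_deriv \<phi>)"

definition weighted_mass ::
    "nat \<Rightarrow> ('a::euclidean_space \<Rightarrow> real) \<Rightarrow> 'a rect_data \<Rightarrow> ennreal" where
  "weighted_mass k f S = (\<integral>\<^sup>+x\<in>carr S. ennreal (f x * real (mult S x)) \<partial>hausdorff k)"


section \<open>Minimizing cones\<close>

definition orientation ::
    "nat \<Rightarrow> 'a::euclidean_space set \<Rightarrow> ('a \<Rightarrow> 'a list) \<Rightarrow> bool" where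
  "orientation k M \<tau> \<longleftrightarrow>
     (\<forall>x\<in>M. orthonormal_frame k (\<tau> x) \<and> span (set (\<tau> x)) = tangent_cone M x) \<and>
     (\<forall>\<phi>. covector k \<phi> \<longrightarrow> continuous_on M (\<lambda>x. \<phi> (\<tau> x)))"

definition truncated_cone ::
    "'a::euclidean_space set \<Rightarrow> ('a \<Rightarrow> 'a list) \<Rightarrow> 'a rect_data" where
  "truncated_cone C \<tau> = \<lparr>carr = C \<inter> cball 0 1, mult = (\<lambda>_. 1), orient = \<tau>\<rparr>"

text \<open>The link of the cone in the unit sphere, as a current, is the boundary of the truncated
  cone.\<close>

definition minimizing_cone ::
    "nat \<Rightarrow> ('a::euclidean_space \<Rightarrow> real) \<Rightarrow> 'a set \<Rightarrow> ('a \<Rightarrow> 'a list) \<Rightarrow> bool" where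
  "minimizing_cone k f C \<tau> \<longleftrightarrow>
     (\<forall>S. rectifiable_current k S \<longrightarrow>
        (\<forall>\<phi>. test_form (k - 1) \<phi> \<longrightarrow>
           boundary (current k S) \<phi> = boundary (current k (truncated_cone C \<tau>)) \<phi>) \<longrightarrow>
        weighted_mass k f (truncated_cone C \<tau>) \<le> weighted_mass k f S)"

definition simons_cone :: "((real ^ 'n) \<times> (real ^ 'n)) set" where
  "simons_cone = {(x, y). (\<Sum>i\<in>UNIV. (x $ i)\<^sup>2) = (\<Sum>i\<in>UNIV. (y $ i)\<^sup>2)}"

end

theory Submission
  imports "Jordan_Normal_Form.Determinant" Defs
begin

text \<open>The proof is by calibration. Write \<open>z = (x, y)\<close>, \<open>n = p + 1\<close>, \<open>\<beta> = \<alpha> - 1\<close> and \<open>vol\<close> for the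
  volume form. For \<open>\<alpha> = 1\<close> the field \<open>X z = (x, - y)\<close> is divergence free, has norm \<open>\<bar>z\<bar>\<close> and is
  normal to the cone, so the closed form \<open>vol(X, \<dots>)\<close> calibrates the cone. For general \<open>\<alpha>\<close> one
  takes \<open>X\<close> to be the field whose form has the primitive \<open>c \<bar>z\<bar>\<^sup>\<beta> vol((x, 0), (0, y), \<dots>)\<close> with
  \<open>c = 1 / (n + \<beta> / 2)\<close>; the bound \<open>\<bar>X z\<bar> \<le> \<bar>z\<bar>\<^sup>\<alpha>\<close> reduces to \<open>4 \<bar>x\<bar>\<^sup>2 \<bar>y\<bar>\<^sup>2 \<le> \<bar>z\<bar>\<^sup>4\<close>, with equality on
  the cone. Replacing \<open>\<bar>z\<bar>\<^sup>2\<close> by \<open>\<bar>z\<bar>\<^sup>2 + \<epsilon>\<close> in the primitive and cutting off far away gives test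
  forms, and \<open>\<epsilon> \<rightarrow> 0\<close> is handled by dominated convergence on both currents.\<close>

text \<open>The boundary condition compares the two currents only on exterior derivatives of smooth
  compactly supported forms, so a closed calibrating form must come with an explicit primitive.
  Contracting \<open>vol\<close> with the two radial fields \<open>(x, 0)\<close> and
  \<open>(0, y)\<close> supplies one: multiplied by any function \<open>f\<close>, its derivative is
  \<open>vol\<close> contracted with the single field
  \<open>((n f + f'(0, y)) x, - (n f + f'(x, 0)) y)\<close>. For \<open>f = c |z|^\<beta>\<close>
  both coefficients reduce on the cone, where |x|^2 = |y|^2 = |z|^2 / 2, to
  \<open>c (n + \<beta> / 2) |z|^\<beta>\<close>; the constant \<open>c\<close> is forced by the
  demand that the field have length |z|^\<alpha> there. For general \<beta> this \<open>f\<close> is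
  not smooth at the origin, hence the \<epsilon>.

  Two obstacles shape the rest. A non-integrable function has integral 0 by default, so Borel sets
  must be shown Hausdorff measurable and the truncated cone of finite measure. And the orientation
  is given only away from the apex: the apex has to be discarded, and the frames agree with the
  normal field up to one global sign only because the cone without its apex is connected.\<close>

no_notation scalar_prod (infix \<open>\<bullet>\<close> 70)

section \<open>Smooth functions\<close>

text \<open>The definition of \<open>C_n\<close> speaks of \<open>frechet_derivative\<close>; by
  uniqueness of derivatives any explicit \<open>f'\<close> may stand for it.\<close>

lemma C_n_SucI:
  assumes "\<And>x. (f has_derivative f' x) (at x)" and "\<And>v. C_n n (\<lambda>x. f' x v)"
  shows "C_n (Suc n) f"
proof -
  have "frechet_derivative f (at x) = f' x" for x
    using frechet_derivative_at[OF assms(1)[of x]] by simp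
  then show ?thesis
    using assms by (auto simp: differentiable_def)
qed

lemma C_n_Suc_has_derivative:
  assumes "C_n (Suc n) f"
  shows "(f has_derivative frechet_derivative f (at x)) (at x)"
  using assms frechet_derivative_works by auto

lemma C_n_Suc_imp_C_n: "C_n (Suc n) f \<Longrightarrow> C_n n f"
proof (induction n arbitrary: f)
  case 0
  then show ?case
    by (auto simp: continuous_on_eq_continuous_at differentiable_imp_continuous_within)
next
  case (Suc n)
  then show ?case
    by (metis C_n.simps(2))
qed

lemma C_n_const: "C_n n (\<lambda>x. c)"
proof (induction n arbitrary: c)
  case (Suc n)
  then show ?case
    by (intro C_n_SucI[where f' = "\<lambda>_ _. 0"]) auto
qed auto

lemma C_n_linear: "bounded_linear f \<Longrightarrow> C_n n f"
proof (cases n)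
  case (Suc k)
  assume "bounded_linear f"
  then show ?thesis
    unfolding Suc by (intro C_n_SucI[where f' = "\<lambda>_. f"] bounded_linear_imp_has_derivative C_n_const)
qed (simp add: linear_continuous_on)

lemma C_n_add:
  assumes "C_n n f" and "C_n n g"
  shows "C_n n (\<lambda>x. f x + g x)"
  using assms
proof (induction n arbitrary: f g)
  case 0
  then show ?case
    by (auto intro: continuous_intros)
next
  case (Suc n)
  show ?case
    by (rule C_n_SucI, rule has_derivative_add)
      (use Suc in \<open>auto intro: C_n_Suc_has_derivative[OF Suc.prems(1)] C_n_Suc_has_derivative[OF Suc.prems(2)]\<close>)
qed

lemma C_n_mult:
  assumes "C_n n f" and "C_n n g"
  shows "C_n n (\<lambda>x. f x * g x)"
  using assms
proof (induction n arbitrary: f g)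
  case 0
  then show ?case
    by (auto intro: continuous_intros)
next
  case (Suc n)
  show ?case
  proof (rule C_n_SucI)
    show "((\<lambda>x. f x * g x) has_derivative
        (\<lambda>v. f x * frechet_derivative g (at x) v + frechet_derivative f (at x) v * g x)) (at x)" for x
      by (intro has_derivative_mult C_n_Suc_has_derivative[OF Suc.prems(1)]
          C_n_Suc_has_derivative[OF Suc.prems(2)])
    show "C_n n (\<lambda>x. f x * frechet_derivative g (at x) v + frechet_derivative f (at x) v * g x)" for v
      using Suc C_n_Suc_imp_C_n[OF Suc.prems(1)] C_n_Suc_imp_C_n[OF Suc.prems(2)]
      by (intro C_n_add Suc.IH) auto
  qed
qed

lemma C_n_bilinear:
  assumes "bounded_bilinear B" and "bounded_linear l" and "bounded_linear m"
  shows "C_n n (\<lambda>x. B (l x) (m x))"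
proof (cases n)
  case 0
  then show ?thesis
    using assms
    by (simp add: bounded_bilinear.continuous_on[OF assms(1)] linear_continuous_on)
next
  case (Suc k)
  interpret bounded_bilinear B by fact
  show ?thesis
    unfolding Suc
  proof (rule C_n_SucI)
    show "((\<lambda>x. B (l x) (m x)) has_derivative (\<lambda>v. B (l x) (m v) + B (l v) (m x))) (at x)" for x
      by (intro FDERIV bounded_linear_imp_has_derivative assms)
    show "C_n k (\<lambda>x. B (l x) (m v) + B (l v) (m x))" for v
      by (intro C_n_add C_n_linear bounded_linear_compose[OF bounded_linear_left assms(2)]
          bounded_linear_compose[OF bounded_linear_right assms(3)])
  qed
qed

text \<open>Differentiating replaces \<open>h j\<close> by \<open>h (Suc j)\<close>, so the
  induction needs a whole sequence, each member the derivative of the one before. Powers and flat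
  functions both come with such a sequence.\<close>

lemma C_n_compose:
  fixes h :: "nat \<Rightarrow> real \<Rightarrow> real"
  assumes "\<And>j u. u \<in> U \<Longrightarrow> (h j has_real_derivative h (Suc j) u) (at u)"
    and "\<And>x. f x \<in> U" and "C_n n f"
  shows "C_n n (\<lambda>x. h j (f x))"
  using assms(3)
proof (induction n arbitrary: j)
  case 0
  show ?case
    using 0 DERIV_isCont[OF assms(1)[OF assms(2)]]
    by (auto simp: continuous_on_eq_continuous_at intro: isCont_o2)
next
  case (Suc n)
  show ?case
  proof (rule C_n_SucI)
    show "((\<lambda>x. h j (f x)) has_derivative
        (\<lambda>v. h (Suc j) (f x) * frechet_derivative f (at x) v)) (at x)" for x
      using has_derivative_compose[OF C_n_Suc_has_derivative[OF Suc.prems]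
          assms(1)[OF assms(2), unfolded has_field_derivative_def]] by simp
    show "C_n n (\<lambda>x. h (Suc j) (f x) * frechet_derivative f (at x) v)" for v
      using Suc C_n_Suc_imp_C_n[OF Suc.prems] by (intro C_n_mult Suc.IH) auto
  qed
qed

lemma C_n_powr:
  assumes "\<And>x. f x > 0" and "C_n n f"
  shows "C_n n (\<lambda>x. f x powr s)"
proof -
  define h where "h j u = (\<Prod>i<j. s - real i) * u powr (s - real j)" for j u
  have "C_n n (\<lambda>x. h 0 (f x))"
  proof (rule C_n_compose[where U = "{0<..}" and h = h])
    fix j :: nat and u :: real
    assume "u \<in> {0<..}"
    then have "(h j has_real_derivative
        (\<Prod>i<j. s - real i) * ((s - real j) * u powr (s - real j - 1))) (at u)"
      unfolding h_def by (auto intro!: derivative_eq_intros)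
    then show "(h j has_real_derivative h (Suc j) u) (at u)"
      by (simp add: h_def algebra_simps)
  qed (use assms in auto)
  then show ?thesis
    by (simp add: h_def)
qed

section \<open>Flat functions and smooth cutoffs\<close>

lemma tendsto_poly_times_exp_minus: "((\<lambda>s. poly P s * exp (- s)) \<longlongrightarrow> 0) (at_top :: real filter)"
proof -
  have "((\<lambda>s. \<Sum>i\<le>degree P. coeff P i * (s ^ i / exp s)) \<longlongrightarrow> (\<Sum>i\<le>degree P. coeff P i * 0))
      (at_top :: real filter)"
    by (intro tendsto_intros tendsto_power_div_exp_0)
  then show ?thesis
    by (simp add: poly_altdef sum_distrib_right exp_minus divide_inverse mult.assoc)
qed

text \<open>Polynomial factors in \<open>1 / t\<close> close the family under differentiation: the
  derivative of \<open>P(1/t) exp(-1/t)\<close> is \<open>t^(-2) (P - P')(1/t) exp(-1/t)\<close>,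
  and \<open>t^(-2)\<close> is the value of \<open>[:0, 0, 1:]\<close> at
  \<open>1 / t\<close>.\<close>

definition flat :: "real poly \<Rightarrow> real \<Rightarrow> real" where
  "flat P t = (if t > 0 then poly P (1 / t) * exp (- 1 / t) else 0)"

lemma has_derivative_flat:
  "(flat P has_real_derivative flat ([:0, 0, 1:] * (P - pderiv P)) t) (at t)"
proof -
  consider "t > 0" | "t < 0" | "t = 0" by linarith
  then show ?thesis
  proof cases
    case 1
    have "((\<lambda>t. poly P (1 / t) * exp (- 1 / t)) has_real_derivative
        flat ([:0, 0, 1:] * (P - pderiv P)) t) (at t)"
      using 1 by (auto intro!: derivative_eq_intros DERIV_chain2[OF poly_DERIV]
          simp: flat_def field_simps power2_eq_square)
    then show ?thesis
      by (rule has_field_derivative_transform_within_open[where S = "{0<..}"])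
        (use 1 in \<open>auto simp: flat_def\<close>)
  next
    case 2
    have "((\<lambda>t. 0) has_real_derivative flat ([:0, 0, 1:] * (P - pderiv P)) t) (at t)"
      using 2 by (auto simp: flat_def)
    then show ?thesis
      by (rule has_field_derivative_transform_within_open[where S = "{..<0}"])
        (use 2 in \<open>auto simp: flat_def\<close>)
  next
    case 3
    have r: "((\<lambda>h. flat P h / h) \<longlongrightarrow> 0) (at_right 0)"
    proof -
      \<comment> \<open>Dividing by \<open>h\<close> multiplies \<open>P\<close> by its variable,
        whose value is \<open>1 / h\<close>.\<close>
      have "((\<lambda>h. poly ([:0, 1:] * P) (inverse h) * exp (- inverse h)) \<longlongrightarrow> 0) (at_right 0)"
        by (rule filterlim_compose[OF tendsto_poly_times_exp_minus filterlim_inverse_at_top_right])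
      then show ?thesis
        by (rule filterlim_cong[THEN iffD1, rotated 3])
          (auto simp: flat_def eventually_at_right_less divide_inverse eventually_at_filter)
    qed
    have l: "((\<lambda>h. flat P h / h) \<longlongrightarrow> 0) (at_left 0)"
      by (rule tendsto_eventually) (auto simp: flat_def eventually_at_filter)
    show ?thesis
      using filterlim_split_at[OF l r]
      by (auto simp: 3 has_field_derivative_iff flat_def)
  qed
qed

lemma C_n_flat:
  assumes "C_n n f"
  shows "C_n n (\<lambda>x. flat P (f x))"
proof -
  define Q where "Q j = ((\<lambda>P. [:0, 0, 1:] * (P - pderiv P)) ^^ j) P" for j
  have "C_n n (\<lambda>x. flat (Q 0) (f x))"
    by (rule C_n_compose[where h = "\<lambda>j. flat (Q j)" and U = UNIV])
      (use assms has_derivative_flat in \<open>auto simp: Q_def\<close>)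
  then show ?thesis
    by (simp add: Q_def)
qed

text \<open>The quotient \<open>a / (a + b)\<close> of two flat functions: \<open>a\<close> vanishes
  from radius \<open>R + 1\<close> on, \<open>b\<close> up to radius \<open>R\<close>, and never
  both at once. They depend on the squared norm, which is smooth also at the origin.\<close>

lemma smooth_cutoff:
  fixes R :: real
  assumes "R \<ge> 0"
  obtains cut :: "'a::euclidean_space \<Rightarrow> real"
  where "\<And>n. C_n n cut" and "\<And>z. norm z \<le> R \<Longrightarrow> cut z = 1" and "\<And>z. norm z \<ge> R + 1 \<Longrightarrow> cut z = 0"
proof
  \<comment> \<open>Differences and the quotient are spelled with sums, products and
    \<open>powr\<close>, the operations for which smoothness has been established.\<close>
  define a where "a z = flat 1 ((R + 1)\<^sup>2 + (- 1) * (z \<bullet> z))" for z :: 'a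
  define b where "b z = flat 1 (z \<bullet> z + - R\<^sup>2)" for z :: 'a
  define cut where "cut z = a z * (a z + b z) powr - 1" for z
  have q: "C_n n (\<lambda>z::'a. z \<bullet> z)" for n
    by (rule C_n_bilinear[OF bounded_bilinear_inner]) auto
  have pos: "a z + b z > 0" for z
  proof -
    have "R\<^sup>2 < (R + 1)\<^sup>2"
      using assms by (simp add: power2_eq_square algebra_simps)
    then have "z \<bullet> z < (R + 1)\<^sup>2 \<or> z \<bullet> z > R\<^sup>2"
      by linarith
    then show ?thesis
      by (auto simp: a_def b_def flat_def intro: add_pos_nonneg add_nonneg_pos)
  qed
  show "C_n n cut" for n
    unfolding cut_def using pos
    unfolding a_def b_def by (intro C_n_mult C_n_powr C_n_flat C_n_add C_n_const q)
  show "cut z = 1" if "norm z \<le> R" for z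
  proof -
    have "z \<bullet> z \<le> R\<^sup>2"
      using that by (simp add: dot_square_norm power_mono)
    then show ?thesis
      using pos[of z] by (simp add: cut_def b_def flat_def powr_minus)
  qed
  show "cut z = 0" if "norm z \<ge> R + 1" for z
  proof -
    have "z \<bullet> z \<ge> (R + 1)\<^sup>2"
      using that assms by (simp add: dot_square_norm power_mono)
    then show ?thesis
      by (simp add: cut_def a_def flat_def)
  qed
qed

section \<open>The volume form\<close>

text \<open>Fixes the order of the columns; another order changes \<open>vol_form\<close> at most by
  a sign.\<close>

definition basis_list :: "'a::euclidean_space list" where
  "basis_list = (SOME bs. distinct bs \<and> set bs = Basis)"

lemma basis_list: "distinct (basis_list :: 'a::euclidean_space list)" "set basis_list = (Basis :: 'a set)"
proof -
  have "\<exists>bs. distinct bs \<and> set bs = (Basis :: 'a set)"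
    using finite_distinct_list[OF finite_Basis] by blast
  from someI_ex[OF this]
  show "distinct (basis_list :: 'a::euclidean_space list)" "set basis_list = (Basis :: 'a set)"
    unfolding basis_list_def by blast+
qed

lemma length_basis_list: "length (basis_list :: 'a::euclidean_space list) = DIM('a)"
  using distinct_card[OF basis_list(1)] basis_list(2) by metis

lemma sum_basis_list:
  "(\<Sum>j<DIM('a::euclidean_space). f (basis_list ! j)) = (\<Sum>b\<in>(Basis :: 'a set). f b)"
  using sum.reindex_bij_betw[OF bij_betw_nth[OF basis_list(1) refl refl], of f]
  by (simp add: length_basis_list basis_list(2))

definition frame_mat :: "'a::euclidean_space list \<Rightarrow> real mat" where
  "frame_mat w = Matrix.mat DIM('a) DIM('a) (\<lambda>(i, j). w ! i \<bullet> basis_list ! j)"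

definition vol_form :: "'a::euclidean_space list \<Rightarrow> real" where
  "vol_form w = Determinant.det (frame_mat w)"

lemma frame_mat_carrier: "frame_mat (w :: 'a::euclidean_space list) \<in> carrier_mat DIM('a) DIM('a)"
  by (simp add: frame_mat_def)

lemma cofactor_frame_mat_cong:
  fixes v w :: "'a::euclidean_space list"
  assumes "\<And>l. l < DIM('a) \<Longrightarrow> l \<noteq> i \<Longrightarrow> v ! l = w ! l"
  shows "cofactor (frame_mat v) i j = cofactor (frame_mat w) i j"
proof -
  have "mat_delete (frame_mat v) i j = mat_delete (frame_mat w) i j"
    using assms by (intro eq_matI) (auto simp: mat_delete_def frame_mat_def)
  then show ?thesis
    by (simp add: cofactor_def)
qed

lemma vol_form_row:
  fixes w :: "'a::euclidean_space list"
  assumes "length w = DIM('a)" and "i < DIM('a)"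
  shows "vol_form (w[i := u]) =
    (\<Sum>j<DIM('a). (u \<bullet> basis_list ! j) * cofactor (frame_mat w) i j)"
  unfolding vol_form_def laplace_expansion_row[OF frame_mat_carrier assms(2)]
proof (rule sum.cong)
  fix j
  assume "j \<in> {..<DIM('a)}"
  moreover have "cofactor (frame_mat (w[i := u])) i j = cofactor (frame_mat w) i j"
    by (rule cofactor_frame_mat_cong) simp
  ultimately show "frame_mat (w[i := u]) $$ (i, j) * cofactor (frame_mat (w[i := u])) i j
      = (u \<bullet> basis_list ! j) * cofactor (frame_mat w) i j"
    using assms by (simp add: frame_mat_def)
qed simp

lemma vol_form_linear:
  fixes w :: "'a::euclidean_space list"
  assumes "length w = DIM('a)" and "i < DIM('a)"
  shows "linear (\<lambda>u. vol_form (w[i := u]))"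
  unfolding vol_form_row[OF assms]
  by (rule linearI) (simp_all add: inner_left_distrib distrib_right sum.distrib sum_distrib_left mult.assoc)

lemma vol_form_identical:
  fixes w :: "'a::euclidean_space list"
  assumes "i < j" "j < DIM('a)" "w ! i = w ! j"
  shows "vol_form w = 0"
  unfolding vol_form_def
  by (rule Determinant.det_identical_rows[OF frame_mat_carrier, of i j])
    (use assms in \<open>auto simp: frame_mat_def Matrix.row_def intro!: eq_vecI\<close>)

text \<open>Cramer's rule, read along the columns.\<close>

lemma vol_form_contract:
  fixes w :: "'a::euclidean_space list"
  assumes w: "length w = DIM('a)"
  shows "(\<Sum>i<DIM('a). (w ! i \<bullet> l) * vol_form (w[i := u])) = (u \<bullet> l) * vol_form w"
proof -
  let ?N = "DIM('a)" and ?b = "\<lambda>j. basis_list ! j :: 'a" and ?M = "frame_mat w"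
  have exp: "v \<bullet> l = (\<Sum>d<?N. (v \<bullet> ?b d) * (l \<bullet> ?b d))" for v
    using euclidean_inner[of v l] by (simp add: sum_basis_list[of "\<lambda>b. (v \<bullet> b) * (l \<bullet> b)"])
  have adj: "(\<Sum>i<?N. cofactor ?M i c * (w ! i \<bullet> ?b d)) = (if c = d then vol_form w else 0)"
    if "c < ?N" "d < ?N" for c d
  proof -
    have "(adj_mat ?M * ?M) $$ (c, d) = (\<Sum>i<?N. cofactor ?M i c * (w ! i \<bullet> ?b d))"
      using that by (simp add: adj_mat_def frame_mat_def scalar_prod_def atLeast0LessThan)
    then show ?thesis
      using that by (auto simp: adj_mat(3)[OF frame_mat_carrier] vol_form_def)
  qed
  have "(\<Sum>i<?N. (w ! i \<bullet> l) * vol_form (w[i := u])) =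
      (\<Sum>i<?N. \<Sum>d<?N. \<Sum>c<?N.
        (l \<bullet> ?b d) * (u \<bullet> ?b c) * (cofactor ?M i c * (w ! i \<bullet> ?b d)))"
  proof (rule sum.cong[OF refl])
    fix i
    assume "i \<in> {..<?N}"
    then have "(w ! i \<bullet> l) * vol_form (w[i := u]) =
        (\<Sum>d<?N. (w ! i \<bullet> ?b d) * (l \<bullet> ?b d)) * (\<Sum>c<?N. (u \<bullet> ?b c) * cofactor ?M i c)"
      by (simp add: vol_form_row[OF w] flip: exp)
    then show "(w ! i \<bullet> l) * vol_form (w[i := u]) = (\<Sum>d<?N. \<Sum>c<?N.
        (l \<bullet> ?b d) * (u \<bullet> ?b c) * (cofactor ?M i c * (w ! i \<bullet> ?b d)))"
      by (simp only: sum_product) (simp only: mult_ac)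
  qed
  also have "\<dots> = (\<Sum>d<?N. \<Sum>c<?N. \<Sum>i<?N.
        (l \<bullet> ?b d) * (u \<bullet> ?b c) * (cofactor ?M i c * (w ! i \<bullet> ?b d)))"
    by (subst sum.swap, rule sum.cong[OF refl], rule sum.swap)
  also have "\<dots> = (\<Sum>d<?N. \<Sum>c<?N.
        (l \<bullet> ?b d) * (u \<bullet> ?b c) * (if c = d then vol_form w else 0))"
    by (intro sum.cong) (auto simp: adj simp flip: sum_distrib_left)
  also have "\<dots> = (u \<bullet> l) * vol_form w"
    by (simp add: exp[of u] sum_distrib_left mult_ac if_distrib[of "\<lambda>x. _ * x"] cong: if_cong)
  finally show ?thesis .
qed

text \<open>A linear map acts as a derivation on the top exterior power by its trace. Expanding
  \<open>P (w ! i)\<close> in the basis gives the coefficients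
  \<open>w ! i \<bullet> adjoint P b\<close>, and for each \<open>b\<close> the sum over
  \<open>i\<close> is a case of Cramer's rule.\<close>

lemma vol_form_trace:
  fixes w :: "'a::euclidean_space list"
  assumes w: "length w = DIM('a)" and P: "linear P"
  shows "(\<Sum>i<DIM('a). vol_form (w[i := P (w ! i)])) = (\<Sum>b\<in>Basis. P b \<bullet> b) * vol_form w"
proof -
  have adj: "x \<bullet> adjoint P b = P x \<bullet> b" for x b
    by (rule adjoint_works[OF P])
  have "vol_form (w[i := P (w ! i)]) = (\<Sum>b\<in>Basis. (w ! i \<bullet> adjoint P b) * vol_form (w[i := b]))"
    if i: "i < DIM('a)" for i
  proof -
    interpret linear "\<lambda>u. vol_form (w[i := u])"
      by (rule vol_form_linear[OF w i])
    have "vol_form (w[i := P (w ! i)]) =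
        vol_form (w[i := (\<Sum>b\<in>Basis. (P (w ! i) \<bullet> b) *\<^sub>R b)])"
      by (simp add: euclidean_representation)
    also have "\<dots> = (\<Sum>b\<in>Basis. (w ! i \<bullet> adjoint P b) * vol_form (w[i := b]))"
      by (simp add: sum scale adj)
    finally show ?thesis .
  qed
  then have "(\<Sum>i<DIM('a). vol_form (w[i := P (w ! i)])) =
      (\<Sum>i<DIM('a). \<Sum>b\<in>Basis. (w ! i \<bullet> adjoint P b) * vol_form (w[i := b]))"
    by simp
  also have "\<dots> = (\<Sum>b\<in>Basis. (b \<bullet> adjoint P b) * vol_form w)"
    by (subst sum.swap) (simp add: vol_form_contract[OF w])
  finally show ?thesis
    by (simp add: adj sum_distrib_right)
qed

text \<open>Expand along the row of \<open>u\<close>: deleting that row leaves the vectors of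
  \<open>w\<close> wherever \<open>u\<close> stood, so only the sign of the cofactor depends on
  \<open>i\<close>.\<close>

lemma vol_form_insert:
  fixes w :: "'a::euclidean_space list"
  assumes w: "Suc (length w) = DIM('a)" and i: "i \<le> length w"
  shows "vol_form (take i w @ u # drop i w) = (-1) ^ i * vol_form (u # w)"
proof -
  define ins where "ins i x = take i w @ x # drop i w" for i x
  have *: "vol_form (ins i u) =
      (-1) ^ i * (\<Sum>j<DIM('a). (u \<bullet> basis_list ! j) *
        ((-1) ^ j * Determinant.det (Matrix.mat (length w) (length w)
          (\<lambda>(r, c). w ! r \<bullet> basis_list ! (if c < j then c else Suc c)))))"
    if i: "i \<le> length w" for i
  proof -
    have N: "DIM('a) = Suc (length w)"
      using w by simp
    have nth: "ins i 0 ! (if r < i then r else Suc r) = w ! r" if "r < length w" for r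
      using that i by (auto simp: ins_def nth_append min_def Suc_diff_le)
    have md: "mat_delete (frame_mat (ins i 0)) i j = Matrix.mat (length w) (length w)
          (\<lambda>(r, c). w ! r \<bullet> basis_list ! (if c < j then c else Suc c))" for j
      by (rule eq_matI) (simp_all add: mat_delete_def frame_mat_def N nth)
    have "vol_form ((ins i 0)[i := u]) =
        (\<Sum>j<DIM('a). (u \<bullet> basis_list ! j) * cofactor (frame_mat (ins i 0)) i j)"
      by (rule vol_form_row) (use i in \<open>simp_all add: N ins_def\<close>)
    then have "vol_form ((ins i 0)[i := u]) = (\<Sum>j<DIM('a). (u \<bullet> basis_list ! j) *
        ((-1) ^ (i + j) * Determinant.det (Matrix.mat (length w) (length w)
          (\<lambda>(r, c). w ! r \<bullet> basis_list ! (if c < j then c else Suc c)))))"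
      by (simp only: cofactor_def md)
    moreover have "(ins i 0)[i := u] = ins i u"
      using i by (simp add: ins_def list_update_append min_def)
    ultimately show ?thesis
      by (simp add: sum_distrib_left power_add mult_ac)
  qed
  have "vol_form (ins i u) = (-1) ^ i * vol_form (ins 0 u)"
    unfolding *[OF i] *[OF le0] by simp
  then show ?thesis
    by (simp add: ins_def)
qed

section \<open>Orthonormal frames and the comass of the volume form\<close>

lemma vol_form_orthonormal:
  fixes w :: "'a::euclidean_space list"
  assumes "orthonormal_frame DIM('a) w"
  shows "\<bar>vol_form w\<bar> = 1"
proof -
  let ?M = "frame_mat w"
  have "(?M * ?M\<^sup>T) $$ (i, j) = w ! i \<bullet> w ! j" if "i < DIM('a)" "j < DIM('a)" for i j
    using that euclidean_inner[of "w ! i" "w ! j"]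
    by (simp add: frame_mat_def scalar_prod_def atLeast0LessThan
        sum_basis_list[of "\<lambda>b. (w ! i \<bullet> b) * (w ! j \<bullet> b)"])
  then have "?M * ?M\<^sup>T = 1\<^sub>m DIM('a)"
    using assms frame_mat_carrier[of w] by (intro eq_matI) (auto simp: orthonormal_frame_def)
  then have "vol_form w * vol_form w = 1"
    using Determinant.det_mult[OF frame_mat_carrier transpose_carrier_mat[THEN iffD2, OF frame_mat_carrier], of w w]
    by (simp add: vol_form_def Determinant.det_transpose[OF frame_mat_carrier])
  then show ?thesis
    by (metis abs_1 abs_minus square_eq_1_iff)
qed

text \<open>In Cramer's rule for the functional \<open>u\<close> only the first row contributes, the
  others being orthogonal to \<open>u\<close>.\<close>

lemma vol_form_Cons_orthonormal:
  fixes v :: "'a::euclidean_space list"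
  assumes "orthonormal_frame DIM('a) (u # v)"
  shows "vol_form (x # v) = (x \<bullet> u) * vol_form (u # v)"
proof -
  have len: "length (u # v) = DIM('a)"
    using assms by (simp add: orthonormal_frame_def)
  have orth: "(u # v) ! i \<bullet> u = (if i = 0 then 1 else 0)" if "i < DIM('a)" for i
  proof -
    have "(u # v) ! i \<bullet> (u # v) ! 0 = (if i = 0 then 1 else 0)"
      using conjunct2[OF assms[unfolded orthonormal_frame_def], rule_format, OF that DIM_positive] .
    then show ?thesis
      by simp
  qed
  have "(x \<bullet> u) * vol_form (u # v) = (\<Sum>i<DIM('a). ((u # v) ! i \<bullet> u) * vol_form ((u # v)[i := x]))"
    by (rule vol_form_contract[OF len, symmetric])
  also have "\<dots> = (\<Sum>i<DIM('a). if i = 0 then vol_form (x # v) else 0)"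
    by (intro sum.cong) (use orth in \<open>auto simp del: nth_Cons_0 nth_Cons_Suc\<close>)
  also have "\<dots> = vol_form (x # v)"
    by (subst sum.delta) auto
  finally show ?thesis
    by simp
qed

lemma orthonormal_frame_Cons:
  assumes "orthonormal_frame k v" and "norm u = 1" and "\<And>x. x \<in> set v \<Longrightarrow> x \<bullet> u = 0"
  shows "orthonormal_frame (Suc k) (u # v)"
  unfolding orthonormal_frame_def
proof (intro conjI allI impI)
  show "length (u # v) = Suc k"
    using assms by (simp add: orthonormal_frame_def)
  have len: "length v = k"
    and v: "\<And>i j. i < k \<Longrightarrow> j < k \<Longrightarrow> v ! i \<bullet> v ! j = (if i = j then 1 else 0)"
    using assms(1) by (auto simp: orthonormal_frame_def)
  have u: "u \<bullet> u = 1" "x \<in> set v \<Longrightarrow> u \<bullet> x = 0" for x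
    using assms(2) assms(3)[of x] by (simp_all add: dot_square_norm inner_commute[of u x])
  fix i j
  assume ij: "i < Suc k" "j < Suc k"
  show "(u # v) ! i \<bullet> (u # v) ! j = (if i = j then 1 else 0)"
  proof (cases i)
    case 0
    then show ?thesis
      using ij by (cases j) (simp_all add: u len)
  next
    case (Suc i')
    then show ?thesis
      using ij by (cases j) (simp_all add: assms(3) len v)
  qed
qed

text \<open>The \<open>k\<close> vectors span a proper subspace, so a unit normal \<open>u\<close>
  completes them to an orthonormal basis. The volume is then \<open>x \<bullet> u\<close> up to
  sign. This turns a length bound for a field into a bound for its form on every orienting
  frame.\<close>

lemma vol_form_Cons_le:
  fixes v :: "'a::euclidean_space list"
  assumes v: "orthonormal_frame k v" and k: "Suc k = DIM('a)"
  shows "\<bar>vol_form (x # v)\<bar> \<le> norm x"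
proof -
  have "dim (set v) \<le> card (set v)"
    by (rule dim_le_card') simp
  also have "\<dots> \<le> k"
    using card_length[of v] v by (simp add: orthonormal_frame_def)
  finally have "dim (set v) < DIM('a)"
    using k by simp
  then obtain a where a: "a \<noteq> 0" "\<And>y. y \<in> span (set v) \<Longrightarrow> Linear_Algebra.orthogonal a y"
    using orthogonal_to_subspace_exists by blast
  define u where "u = a /\<^sub>R norm a"
  have "y \<bullet> u = 0" if "y \<in> set v" for y
    using a(2)[OF span_base[OF that]]
    by (simp add: u_def Linear_Algebra.orthogonal_def inner_commute[of y])
  moreover have u: "norm u = 1"
    using a(1) by (simp add: u_def)
  ultimately have on: "orthonormal_frame DIM('a) (u # v)"
    using orthonormal_frame_Cons[OF v, of u] k by simp
  have "\<bar>x \<bullet> u\<bar> \<le> norm x"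
    using Cauchy_Schwarz_ineq2[of x u] u by simp
  then show ?thesis
    using vol_form_orthonormal[OF on] vol_form_Cons_orthonormal[OF on, of x] by (simp add: abs_mult)
qed

section \<open>Borel sets are Hausdorff measurable\<close>

lemma hausdorff_size_mono:
  assumes "A \<subseteq> B" "bounded B"
  shows "hausdorff_size k A \<le> hausdorff_size k B"
proof (cases "A = {}")
  case False
  have "diameter A / 2 \<le> diameter B / 2" "0 \<le> diameter A / 2"
    using diameter_subset[OF assms] diameter_ge_0[OF bounded_subset[OF assms(2,1)]] by auto
  then show ?thesis
    using False assms unfolding hausdorff_size_def
    by (auto intro!: ennreal_leI mult_left_mono power_mono)
qed (simp add: hausdorff_size_def)

text \<open>The Hausdorff content at scale \<delta>, kept apart from the supremum because separated
  sets add up only at scales below their distance.\<close>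

definition hausdorff_pre :: "nat \<Rightarrow> real \<Rightarrow> 'a::euclidean_space set \<Rightarrow> ennreal" where
  "hausdorff_pre k \<delta> A = (INF C\<in>hausdorff_covers \<delta> A. \<Sum>i. hausdorff_size k (C i))"

lemma hausdorff_outer_eq_SUP: "hausdorff_outer k A = (SUP \<delta>\<in>{0<..}. hausdorff_pre k \<delta> A)"
  by (simp add: hausdorff_outer_def hausdorff_pre_def)

lemma hausdorff_pre_antimono:
  assumes "\<delta> \<le> \<epsilon>"
  shows "hausdorff_pre k \<epsilon> A \<le> hausdorff_pre k \<delta> A"
  unfolding hausdorff_pre_def
  by (rule INF_superset_mono) (use assms in \<open>auto simp: hausdorff_covers_def intro: order_trans\<close>)

text \<open>A covering set of diameter at most \<delta> cannot meet both \<open>A\<close> and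
  \<open>B\<close>, so a covering of the union splits into coverings of the two at no extra
  cost.\<close>

lemma hausdorff_pre_separated:
  fixes A B :: "'a::euclidean_space set"
  assumes sep: "\<And>x y. x \<in> A \<Longrightarrow> y \<in> B \<Longrightarrow> dist x y > \<delta>"
  shows "hausdorff_pre k \<delta> A + hausdorff_pre k \<delta> B \<le> hausdorff_pre k \<delta> (A \<union> B)"
  unfolding hausdorff_pre_def[of _ _ "A \<union> B"]
proof (rule INF_greatest)
  fix C
  assume C: "C \<in> hausdorff_covers \<delta> (A \<union> B)"
  have bdd: "bounded (C i)" "diameter (C i) \<le> \<delta>" for i
    using C by (auto simp: hausdorff_covers_def)
  have sub: "bounded (C i \<inter> D) \<and> diameter (C i \<inter> D) \<le> \<delta>" for i D
    using bdd[of i] diameter_subset[of "C i \<inter> D" "C i"] by (auto intro: bounded_subset)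
  have "(\<lambda>i. C i \<inter> A) \<in> hausdorff_covers \<delta> A" "(\<lambda>i. C i \<inter> B) \<in> hausdorff_covers \<delta> B"
    using C sub by (auto simp: hausdorff_covers_def)
  then have "hausdorff_pre k \<delta> A + hausdorff_pre k \<delta> B \<le>
      (\<Sum>i. hausdorff_size k (C i \<inter> A)) + (\<Sum>i. hausdorff_size k (C i \<inter> B))"
    unfolding hausdorff_pre_def by (intro add_mono INF_lower)
  also have "\<dots> = (\<Sum>i. hausdorff_size k (C i \<inter> A) + hausdorff_size k (C i \<inter> B))"
    by (rule suminf_add) auto
  also have "\<dots> \<le> (\<Sum>i. hausdorff_size k (C i))"
  proof (intro suminf_le)
    fix i
    have "C i \<inter> A = {} \<or> C i \<inter> B = {}"
      using sep diameter_bounded_bound[OF bdd(1)[of i]] bdd(2)[of i] by fastforce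
    then show "hausdorff_size k (C i \<inter> A) + hausdorff_size k (C i \<inter> B) \<le> hausdorff_size k (C i)"
      using hausdorff_size_mono[OF Int_lower1 bdd(1)[of i], of k]
      by (auto simp: hausdorff_size_def[of k "{}"])
  qed auto
  finally show "hausdorff_pre k \<delta> A + hausdorff_pre k \<delta> B \<le> (\<Sum>i. hausdorff_size k (C i))" .
qed

lemma hausdorff_outer_separated:
  fixes A B :: "'a::euclidean_space set"
  assumes "\<epsilon> > 0" and sep: "\<And>x y. x \<in> A \<Longrightarrow> y \<in> B \<Longrightarrow> dist x y \<ge> \<epsilon>"
  shows "hausdorff_outer k A + hausdorff_outer k B \<le> hausdorff_outer k (A \<union> B)"
proof -
  have "hausdorff_outer k A + hausdorff_outer k B =
      (SUP \<delta>\<in>{0<..}. hausdorff_pre k \<delta> A + hausdorff_pre k \<delta> B)"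
    unfolding hausdorff_outer_eq_SUP
  proof (rule SUP_add_directed_ennreal[symmetric])
    fix \<delta> \<epsilon> :: real
    assume "\<delta> \<in> {0<..}" "\<epsilon> \<in> {0<..}"
    then show "\<exists>\<eta>\<in>{0<..}. hausdorff_pre k \<delta> A + hausdorff_pre k \<epsilon> B
        \<le> hausdorff_pre k \<eta> A + hausdorff_pre k \<eta> B"
      by (intro bexI[of _ "min \<delta> \<epsilon>"] add_mono hausdorff_pre_antimono) auto
  qed
  also have "\<dots> \<le> hausdorff_outer k (A \<union> B)"
  proof (rule SUP_least)
    fix \<delta> :: real
    assume "\<delta> \<in> {0<..}"
    \<comment> \<open>Halving \<epsilon> gives the strict separation at scale \<eta>; passing to a
      smaller scale only increases the contents.\<close>
    define \<eta> where "\<eta> = min \<delta> (\<epsilon> / 2)"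
    have \<eta>: "\<eta> > 0" "\<eta> \<le> \<delta>" "\<eta> < \<epsilon>"
      using \<open>\<delta> \<in> _\<close> \<open>\<epsilon> > 0\<close> by (auto simp: \<eta>_def)
    have "hausdorff_pre k \<delta> A + hausdorff_pre k \<delta> B \<le> hausdorff_pre k \<eta> A + hausdorff_pre k \<eta> B"
      by (intro add_mono hausdorff_pre_antimono \<eta>)
    also have "\<dots> \<le> hausdorff_pre k \<eta> (A \<union> B)"
      by (rule hausdorff_pre_separated) (use sep \<eta> in force)
    also have "\<dots> \<le> hausdorff_outer k (A \<union> B)"
      unfolding hausdorff_outer_eq_SUP by (rule SUP_upper) (use \<eta> in simp)
    finally show "hausdorff_pre k \<delta> A + hausdorff_pre k \<delta> B \<le> hausdorff_outer k (A \<union> B)" .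
  qed
  finally show ?thesis .
qed

lemma hausdorff_outer_Un_le: "hausdorff_outer k (A \<union> B) \<le> hausdorff_outer k A + hausdorff_outer k B"
proof -
  let ?C = "\<lambda>i::nat. if i = 0 then A else if i = 1 then B else {}"
  have "(\<Union>i. ?C i) = A \<union> B"
    by (auto split: if_splits)
  moreover have "(\<Sum>i. hausdorff_outer k (?C i)) = (\<Sum>i\<in>{0, 1}. hausdorff_outer k (?C i))"
    by (rule suminf_finite) (auto simp: hausdorff_outer_empty)
  ultimately show ?thesis
    using hausdorff_outer_countably_subadditive[of k ?C] by simp
qed

text \<open>Caratheodory's criterion: the layers \<open>R j\<close> around the closed set are pairwise separated when
  their indices have the same parity, so their measures have a finite sum and vanishing tails.\<close>

lemma closed_in_lambda_system:
  fixes F :: "'a::euclidean_space set"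
  assumes F: "closed F" "F \<noteq> {}"
  shows "hausdorff_outer k (F \<inter> A) + hausdorff_outer k (A - F) \<le> hausdorff_outer k A"
proof (cases "hausdorff_outer k A = \<infinity>")
  case False
  let ?\<mu> = "hausdorff_outer k :: 'a set \<Rightarrow> ennreal" and ?d = "\<lambda>x. infdist x F"
  define G where "G n = {x \<in> A. 1 / real (Suc n) \<le> ?d x}" for n
  define R where "R j = {x \<in> A. 1 / real (j + 2) \<le> ?d x \<and> ?d x < 1 / real (j + 1)}" for j
  have lip: "?d x - ?d y \<le> dist x y" for x y
    using infdist_triangle[of x F y] by (simp add: dist_commute)
  have parity: "(\<Sum>j<m. ?\<mu> (R (2 * j + c))) \<le> ?\<mu> (\<Union>j<m. R (2 * j + c))" for m c
  proof (induction m)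
    case (Suc m)
    have "(\<Sum>j<Suc m. ?\<mu> (R (2 * j + c))) \<le> ?\<mu> (\<Union>j<m. R (2 * j + c)) + ?\<mu> (R (2 * m + c))"
      using Suc by (simp add: add_right_mono)
    also have "\<dots> \<le> ?\<mu> ((\<Union>j<m. R (2 * j + c)) \<union> R (2 * m + c))"
    proof (cases "m = 0")
      case False
      \<comment> \<open>The layer of index \<open>2 * m + c - 1\<close> lies in between: the earlier
        layers have distance at least \<open>1 / (2 * m + c)\<close> from \<open>F\<close>, the new
        one less than \<open>1 / (2 * m + c + 1)\<close>. Here \<open>m > 0\<close> keeps the first
        denominator positive.\<close>
      let ?\<epsilon> = "1 / real (2 * m + c) - 1 / real (2 * m + c + 1)"
      show ?thesis
      proof (rule hausdorff_outer_separated)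
        show "?\<epsilon> > 0"
          using False by (simp add: frac_less2)
        fix x y
        assume "x \<in> (\<Union>j<m. R (2 * j + c))" and y: "y \<in> R (2 * m + c)"
        then obtain j where "j < m" "1 / real (2 * j + c + 2) \<le> ?d x"
          by (auto simp: R_def)
        moreover from \<open>j < m\<close> have "1 / real (2 * m + c) \<le> 1 / real (2 * j + c + 2)"
          by (intro divide_left_mono) auto
        ultimately show "?\<epsilon> \<le> dist x y"
          using y lip[of x y] by (auto simp: R_def)
      qed
    qed (simp add: hausdorff_outer_empty)
    also have "(\<Union>j<m. R (2 * j + c)) \<union> R (2 * m + c) = (\<Union>j<Suc m. R (2 * j + c))"
      by (auto simp: lessThan_Suc)
    finally show ?case .
  qed (simp add: hausdorff_outer_empty)
  have half: "(\<Sum>j<m. ?\<mu> (R (2 * j + c))) \<le> ?\<mu> A" for m c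
    using parity by (rule order_trans) (auto intro!: hausdorff_outer_mono simp: R_def)
  have "(\<Sum>j<m. ?\<mu> (R j)) \<le> 2 * ?\<mu> A" for m
  proof -
    have "(\<Sum>j<m. ?\<mu> (R j)) \<le> (\<Sum>j<2 * m. ?\<mu> (R j))"
      by (rule sum_mono2) auto
    also have "\<dots> = (\<Sum>j<m. ?\<mu> (R (2 * j + 0))) + (\<Sum>j<m. ?\<mu> (R (2 * j + 1)))"
      by (induction m) (simp_all add: algebra_simps)
    also have "\<dots> \<le> ?\<mu> A + ?\<mu> A"
      by (intro add_mono half)
    finally show ?thesis
      by (simp add: mult_2)
  qed
  then have "(\<Sum>j. ?\<mu> (R j)) \<le> 2 * ?\<mu> A"
    by (intro suminf_le_const) auto
  also have "\<dots> < \<infinity>"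
    using False by (simp add: ennreal_mult_less_top less_top)
  finally have fin: "(\<Sum>j. ?\<mu> (R j)) < \<infinity>" .
  have diff: "?\<mu> (A - F) \<le> ?\<mu> (G n) + (\<Sum>j. ?\<mu> (R (j + n)))" for n
  proof -
    have "A - F \<subseteq> G n \<union> (\<Union>j. R (j + n))"
    proof
      fix x
      assume x: "x \<in> A - F"
      then have pos: "?d x > 0"
        using F by (metis DiffD2 in_closed_iff_infdist_zero infdist_nonneg order_le_less)
      \<comment> \<open>The least such \<open>l\<close> locates \<open>x\<close>: it lies in
        \<open>G n\<close> if \<open>l \<le> n\<close>, and otherwise in the layer
        \<open>R (l - 1)\<close>.\<close>
      define l where "l = (LEAST l. 1 / real (Suc l) \<le> ?d x)"
      have "\<exists>l. 1 / real (Suc l) \<le> ?d x"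
        using reals_Archimedean[OF pos] by (auto simp: inverse_eq_divide intro: less_imp_le)
      then have l: "1 / real (Suc l) \<le> ?d x"
        unfolding l_def by (rule LeastI_ex)
      have min: "?d x < 1 / real (Suc i)" if "i < l" for i
        using not_less_Least[of i "\<lambda>l. 1 / real (Suc l) \<le> ?d x"] that by (simp add: l_def not_le)
      show "x \<in> G n \<union> (\<Union>j. R (j + n))"
      proof (cases "l \<le> n")
        case True
        then have "1 / real (Suc n) \<le> 1 / real (Suc l)"
          by (intro divide_left_mono) auto
        then show ?thesis
          using l x by (auto simp: G_def)
      next
        case False
        then obtain j where j: "l = Suc (j + n)"
          using less_imp_Suc_add[of n l] by (auto simp: add.commute)
        then have "x \<in> R (j + n)"
          using l min[of "j + n"] x by (auto simp: R_def)
        then show ?thesis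
          by blast
      qed
    qed
    then have "?\<mu> (A - F) \<le> ?\<mu> (G n) + ?\<mu> (\<Union>j. R (j + n))"
      by (meson hausdorff_outer_Un_le hausdorff_outer_mono order_trans)
    also have "\<dots> \<le> ?\<mu> (G n) + (\<Sum>j. ?\<mu> (R (j + n)))"
      by (intro add_left_mono hausdorff_outer_countably_subadditive)
    finally show ?thesis .
  qed
  have sep: "?\<mu> (F \<inter> A) + ?\<mu> (G n) \<le> ?\<mu> A" for n
  proof -
    have "?\<mu> (F \<inter> A) + ?\<mu> (G n) \<le> ?\<mu> (F \<inter> A \<union> G n)"
    proof (rule hausdorff_outer_separated)
      show "1 / real (Suc n) > 0"
        by simp
      fix x y
      assume "x \<in> F \<inter> A" "y \<in> G n"
      then show "1 / real (Suc n) \<le> dist x y"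
        using lip[of y x] by (auto simp: G_def dist_commute)
    qed
    also have "\<dots> \<le> ?\<mu> A"
      by (rule hausdorff_outer_mono) (auto simp: G_def)
    finally show ?thesis .
  qed
  \<comment> \<open>To avoid subtracting extended reals, the vanishing of the tails is expressed by
    adding partial sums on the left and the full sum on the right; in the limit the finite full sum
    cancels.\<close>
  have "?\<mu> (F \<inter> A) + ?\<mu> (A - F) + (\<Sum>j<n. ?\<mu> (R j)) \<le> ?\<mu> A + (\<Sum>j. ?\<mu> (R j))" for n
  proof -
    have "?\<mu> (F \<inter> A) + ?\<mu> (A - F) + (\<Sum>j<n. ?\<mu> (R j)) \<le>
        (?\<mu> (F \<inter> A) + ?\<mu> (G n)) + ((\<Sum>j. ?\<mu> (R (j + n))) + (\<Sum>j<n. ?\<mu> (R j)))"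
      using add_left_mono[OF diff[of n], of "?\<mu> (F \<inter> A)"]
      by (simp add: add_right_mono add.assoc[symmetric])
    also have "\<dots> = (?\<mu> (F \<inter> A) + ?\<mu> (G n)) + (\<Sum>j. ?\<mu> (R j))"
      using suminf_offset[of "\<lambda>j. ?\<mu> (R j)" n] by simp
    finally show ?thesis
      using sep[of n] by (meson add_right_mono order_trans)
  qed
  moreover have "(\<lambda>n. ?\<mu> (F \<inter> A) + ?\<mu> (A - F) + (\<Sum>j<n. ?\<mu> (R j))) \<longlonglongrightarrow>
      ?\<mu> (F \<inter> A) + ?\<mu> (A - F) + (\<Sum>j. ?\<mu> (R j))"
    by (intro tendsto_intros summable_LIMSEQ) auto
  ultimately have "?\<mu> (F \<inter> A) + ?\<mu> (A - F) + (\<Sum>j. ?\<mu> (R j)) \<le> ?\<mu> A + (\<Sum>j. ?\<mu> (R j))"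
    by (intro LIMSEQ_le_const2) auto
  then show ?thesis
    using fin by (metis add.commute ennreal_add_left_cancel_le less_irrefl infinity_ennreal_def)
qed simp

lemma borel_in_sets_hausdorff:
  assumes "A \<in> sets (borel :: 'a::euclidean_space measure)"
  shows "A \<in> sets (hausdorff k)"
proof -
  have "F \<in> sets (hausdorff k)" if F: "closed F" for F :: "'a set"
  proof (cases "F = {}")
    case False
    have "hausdorff_outer k (F \<inter> A) + hausdorff_outer k (A - F) = hausdorff_outer k A" for A
      using closed_in_lambda_system[OF F False] hausdorff_outer_Un_le[of k "F \<inter> A" "A - F"]
      by (auto intro!: antisym simp: Un_Diff_Int Int_commute Un_commute)
    moreover have "(UNIV - F) \<inter> A = A - F" for A
      by blast
    ultimately show ?thesis
      by (simp add: sets_hausdorff lambda_system_def)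
  qed simp
  then have "sigma_sets UNIV {F :: 'a set. closed F} \<subseteq> sets (hausdorff k)"
    by (intro sets.sigma_sets_subset[of _ "hausdorff k", unfolded space_hausdorff]) auto
  moreover have "sets borel = sigma_sets UNIV {F :: 'a set. closed F}"
    by (simp add: borel_eq_closed)
  ultimately show ?thesis
    using assms by blast
qed

section \<open>The truncated cone has finite Hausdorff measure\<close>

text \<open>Bounded cardinalities give a separated set with the greatest number of points. A point
  of \<open>A\<close> outside all the balls could be added to it.\<close>

lemma maximal_separated_subset:
  assumes bound: "\<And>T. T \<subseteq> A \<Longrightarrow> finite T \<Longrightarrow> pairwise (\<lambda>x y. dist x y \<ge> \<eta>) T \<Longrightarrow> card T \<le> B"
    and "\<eta> > 0"
  obtains T where "T \<subseteq> A" "finite T" "pairwise (\<lambda>x y. dist x y \<ge> \<eta>) T" "A \<subseteq> (\<Union>t\<in>T. cball t \<eta>)"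
proof -
  let ?P = "\<lambda>T. T \<subseteq> A \<and> finite T \<and> pairwise (\<lambda>x y. dist x y \<ge> \<eta>) T"
  obtain T where T: "?P T" and max: "\<And>S. ?P S \<Longrightarrow> card S \<le> card T"
    using ex_has_greatest_nat[of ?P "{}" card "Suc B"] bound by (auto simp: less_Suc_eq_le)
  have "a \<in> (\<Union>t\<in>T. cball t \<eta>)" if a: "a \<in> A" for a
  proof (rule ccontr)
    assume far: "a \<notin> (\<Union>t\<in>T. cball t \<eta>)"
    then have "a \<notin> T" "?P (insert a T)"
      using T a \<open>\<eta> > 0\<close> by (auto simp: pairwise_insert dist_commute[of a] not_le)
    then show False
      using max[of "insert a T"] T by simp
  qed
  then show thesis
    using that T by blast
qed

text \<open>The hypothesis says that the upper Minkowski content is finite: it bounds the cardinality of a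
  maximal separated subset, around which balls cover \<open>A\<close>.\<close>

lemma hausdorff_outer_finite:
  fixes A :: "'a::euclidean_space set"
  assumes k: "Suc k = DIM('a)" and "K \<ge> 0"
    and tube: "\<And>\<eta>. 0 < \<eta> \<Longrightarrow> \<eta> \<le> 1 \<Longrightarrow>
      \<exists>U\<in>sets lborel. (\<Union>a\<in>A. ball a \<eta>) \<subseteq> U \<and> emeasure lborel U \<le> ennreal (K * \<eta>)"
  shows "hausdorff_outer k A < \<infinity>"
proof -
  define c where "c = unit_ball_vol (real DIM('a))"
  define L where "L = K * 2 ^ DIM('a) / c * unit_ball_vol (real k)"
  have c: "c > 0"
    by (simp add: c_def)
  have "(INF C\<in>hausdorff_covers \<delta> A. \<Sum>i. hausdorff_size k (C i)) \<le> ennreal L" if "\<delta> > 0" for \<delta>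
  proof -
    \<comment> \<open>A ball of radius \<eta> has diameter at most \<delta>, and the tube estimate
      is available for radii up to 1.\<close>
    define \<eta> where "\<eta> = min (\<delta> / 2) 1"
    have \<eta>: "0 < \<eta>" "\<eta> \<le> 1" "2 * \<eta> \<le> \<delta>"
      using that by (auto simp: \<eta>_def)
    obtain U where U: "U \<in> sets lborel" "(\<Union>a\<in>A. ball a \<eta>) \<subseteq> U"
      "emeasure lborel U \<le> ennreal (K * \<eta>)"
      using tube[OF \<eta>(1,2)] by blast
    \<comment> \<open>The disjoint balls of radius \<open>\<eta> / 2\<close> around \<open>T\<close>
      lie in \<open>U\<close>. Their volumes scale with the power \<open>k + 1\<close> of \<eta>,
      that of \<open>U\<close> with the first, so one factor cancels and
      \<open>card T * \<eta> ^ k\<close> is bounded independently of \<eta>.\<close>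
    have card: "real (card T) * \<eta> ^ k \<le> K * 2 ^ DIM('a) / c"
      if T: "T \<subseteq> A" "finite T" "pairwise (\<lambda>x y. dist x y \<ge> \<eta>) T" for T
    proof -
      have "disjoint_family_on (\<lambda>t. ball t (\<eta> / 2)) T"
        unfolding disjoint_family_on_def
      proof (intro ballI impI)
        fix s t
        assume "s \<in> T" "t \<in> T" "s \<noteq> t"
        then have "dist s t \<ge> \<eta>"
          using T(3) by (auto simp: pairwise_def)
        then show "ball s (\<eta> / 2) \<inter> ball t (\<eta> / 2) = {}"
          by (intro disjoint_ballI) simp
      qed
      then have "(\<Sum>t\<in>T. emeasure lborel (ball t (\<eta> / 2))) = emeasure lborel (\<Union>t\<in>T. ball t (\<eta> / 2))"
        using T(2) by (intro sum_emeasure) auto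
      also have "\<dots> \<le> emeasure lborel U"
      proof (rule emeasure_mono)
        have "(\<Union>t\<in>T. ball t (\<eta> / 2)) \<subseteq> (\<Union>a\<in>A. ball a \<eta>)"
          by (intro UN_mono T(1) subset_ball) (use \<eta>(1) in simp)
        then show "(\<Union>t\<in>T. ball t (\<eta> / 2)) \<subseteq> U"
          using U(2) by blast
      qed (use U in simp)
      also have "\<dots> \<le> ennreal (K * \<eta>)"
        by (rule U(3))
      also have "(\<Sum>t\<in>T. emeasure lborel (ball t (\<eta> / 2))) =
          ennreal (real (card T) * (c * (\<eta> / 2) ^ DIM('a)))"
        using \<eta>(1) c
        by (simp add: emeasure_ball c_def ennreal_mult ennreal_of_nat_eq_real_of_nat)
      finally have "real (card T) * (c * (\<eta> / 2) ^ DIM('a)) \<le> K * \<eta>"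
        using \<open>K \<ge> 0\<close> \<eta>(1) by (subst (asm) ennreal_le_iff) auto
      also have "real (card T) * (c * (\<eta> / 2) ^ DIM('a)) =
          \<eta> * (real (card T) * \<eta> ^ k * (c / 2 ^ DIM('a)))"
      proof -
        have "(\<eta> / 2) ^ DIM('a) = \<eta> * \<eta> ^ k / 2 ^ DIM('a)"
          unfolding k[symmetric] by (simp add: power_divide)
        then show ?thesis
          by (simp add: mult_ac)
      qed
      also have "K * \<eta> = \<eta> * K"
        by simp
      finally have "real (card T) * \<eta> ^ k * (c / 2 ^ DIM('a)) \<le> K"
        by (rule mult_left_le_imp_le) (rule \<eta>(1))
      then have "real (card T) * \<eta> ^ k * c \<le> K * 2 ^ DIM('a)"
        by (simp add: pos_divide_le_eq)
      then show ?thesis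
        by (simp only: pos_le_divide_eq[OF c])
    qed
    obtain B :: nat where B: "K * 2 ^ DIM('a) / c / \<eta> ^ k \<le> real B"
      using real_arch_simple by blast
    have card': "real (card T) \<le> K * 2 ^ DIM('a) / c / \<eta> ^ k"
      if "T \<subseteq> A" "finite T" "pairwise (\<lambda>x y. dist x y \<ge> \<eta>) T" for T
      using card[OF that] \<eta>(1) by (simp only: pos_le_divide_eq zero_less_power)
    have "card T \<le> B" if "T \<subseteq> A" "finite T" "pairwise (\<lambda>x y. dist x y \<ge> \<eta>) T" for T
      using order_trans[OF card'[OF that] B] by simp
    then obtain T where T: "T \<subseteq> A" "finite T" "pairwise (\<lambda>x y. dist x y \<ge> \<eta>) T"
      "A \<subseteq> (\<Union>t\<in>T. cball t \<eta>)"
      by (rule maximal_separated_subset[OF _ \<eta>(1)])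
    obtain h where h: "bij_betw h {0..<card T} T"
      using ex_bij_betw_nat_finite[OF T(2)] by blast
    define C where "C i = (if i < card T then cball (h i) \<eta> else {})" for i
    have diam: "diameter (C i) \<le> 2 * \<eta>" for i
      using \<eta>(1) by (auto simp: C_def diameter_cball)
    have "cball t \<eta> \<subseteq> (\<Union>i. C i)" if "t \<in> T" for t
    proof -
      have "t \<in> h ` {0..<card T}"
        using bij_betw_imp_surj_on[OF h] that by simp
      then obtain i where "i < card T" "t = h i"
        by auto
      then show ?thesis
        by (intro UN_upper[of i, THEN subset_trans[rotated]]) (auto simp: C_def)
    qed
    then have "A \<subseteq> (\<Union>i. C i)"
      by (intro subset_trans[OF T(4) UN_least])
    then have "C \<in> hausdorff_covers \<delta> A"
      using order_trans[OF diam \<eta>(3)] by (auto simp: hausdorff_covers_def C_def)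
    then have "(INF C\<in>hausdorff_covers \<delta> A. \<Sum>i. hausdorff_size k (C i)) \<le> (\<Sum>i. hausdorff_size k (C i))"
      by (rule INF_lower)
    also have "\<dots> = (\<Sum>i<card T. hausdorff_size k (C i))"
      by (rule suminf_finite) (auto simp: C_def hausdorff_size_def)
    also have "\<dots> \<le> (\<Sum>i<card T. ennreal (unit_ball_vol (real k) * \<eta> ^ k))"
    proof (rule sum_mono)
      fix i
      have "(diameter (C i) / 2) ^ k \<le> \<eta> ^ k"
        using diam[of i] by (intro power_mono) (auto intro!: diameter_ge_0 simp: C_def)
      then show "hausdorff_size k (C i) \<le> ennreal (unit_ball_vol (real k) * \<eta> ^ k)"
        by (auto simp: hausdorff_size_def intro!: ennreal_leI mult_left_mono)
    qed
    also have "\<dots> = ennreal (real (card T) * \<eta> ^ k * unit_ball_vol (real k))"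
      using \<eta>(1) by (simp add: ennreal_mult ennreal_of_nat_eq_real_of_nat mult_ac)
    also have "\<dots> \<le> ennreal L"
      unfolding L_def by (intro ennreal_leI mult_right_mono card[OF T(1-3)]) simp
    finally show ?thesis .
  qed
  then have "hausdorff_outer k A \<le> ennreal L"
    unfolding hausdorff_outer_def by (intro SUP_least) simp
  then show ?thesis
    by (rule order.strict_trans1) simp
qed

lemma power_diff_le:
  fixes a b M :: real
  assumes "0 \<le> b" "b \<le> a" "a \<le> M" "1 \<le> M"
  shows "a ^ n - b ^ n \<le> real n * M ^ n * (a - b)"
proof (induction n)
  case (Suc n)
  have "a ^ Suc n - b ^ Suc n = a * (a ^ n - b ^ n) + b ^ n * (a - b)"
    by (simp add: algebra_simps)
  also have "\<dots> \<le> M * (real n * M ^ n * (a - b)) + M ^ Suc n * (a - b)"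
  proof (intro add_mono mult_right_mono mult_mono)
    have "b ^ n \<le> M ^ n"
      using assms by (intro power_mono) auto
    also have "\<dots> \<le> M ^ Suc n"
      using assms by (intro power_increasing) auto
    finally show "b ^ n \<le> M ^ Suc n" .
  qed (use assms Suc in \<open>auto intro: power_mono\<close>)
  finally show ?case
    by (simp add: algebra_simps)
qed simp

text \<open>By Fubini: for fixed \<open>x\<close> the section lies in a spherical shell of width at
  most \<open>4 * \<eta>\<close> and outer radius at most 4, so its volume is linear in \<eta>; the
  \<open>x\<close> themselves range over a ball of radius 2.\<close>

lemma emeasure_cone_tube:
  fixes \<eta> :: real
  assumes \<eta>: "0 < \<eta>" "\<eta> \<le> 1"
  defines "U \<equiv> {z :: 'a::euclidean_space \<times> 'b::euclidean_space.
    norm (fst z) \<le> 2 \<and> \<bar>norm (fst z) - norm (snd z)\<bar> \<le> 2 * \<eta>}"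
  shows "U \<in> sets lborel"
    and "emeasure lborel U \<le> ennreal (unit_ball_vol DIM('a) * 2 ^ DIM('a) *
      (unit_ball_vol DIM('b) * (real DIM('b) * 4 ^ DIM('b) * 4)) * \<eta>)"
proof -
  let ?n = "DIM('b)" and ?c = "unit_ball_vol (real DIM('b))"
  have "closed U"
    unfolding U_def by (intro closed_Collect_conj closed_Collect_le continuous_intros)
  then show U: "U \<in> sets lborel"
    by simp
  have sec: "emeasure lborel (Pair x -` U) \<le>
      ennreal (?c * (real ?n * 4 ^ ?n * (4 * \<eta>))) * indicator (cball 0 2) x" for x
  proof (cases "norm x \<le> 2")
    case True
    define a where "a = norm x + 2 * \<eta>"
    define b where "b = max 0 (norm x - 2 * \<eta>)"
    have ab: "0 \<le> b" "b \<le> a" "a \<le> 4" "a - b \<le> 4 * \<eta>"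
      using True \<eta> by (auto simp: a_def b_def)
    have "Pair x -` U \<subseteq> cball 0 a - ball 0 b"
      by (auto simp: U_def a_def b_def max_def split: if_splits)
    then have "emeasure lborel (Pair x -` U) \<le> emeasure lborel (cball (0::'b) a - ball 0 b)"
      by (intro emeasure_mono) auto
    also have "\<dots> = emeasure lborel (cball (0::'b) a) - emeasure lborel (ball (0::'b) b)"
      using ab by (intro emeasure_Diff) (auto simp: emeasure_ball)
    also have "\<dots> = ennreal (?c * a ^ ?n - ?c * b ^ ?n)"
      using ab by (simp add: emeasure_cball emeasure_ball ennreal_minus)
    also have "\<dots> \<le> ennreal (?c * (real ?n * 4 ^ ?n * (4 * \<eta>)))"
    proof (rule ennreal_leI)
      have "a ^ ?n - b ^ ?n \<le> real ?n * 4 ^ ?n * (a - b)"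
        by (rule power_diff_le) (use ab in auto)
      also have "\<dots> \<le> real ?n * 4 ^ ?n * (4 * \<eta>)"
        by (intro mult_left_mono ab) auto
      finally show "?c * a ^ ?n - ?c * b ^ ?n \<le> ?c * (real ?n * 4 ^ ?n * (4 * \<eta>))"
        unfolding right_diff_distrib[symmetric] by (intro mult_left_mono) auto
    qed
    finally show ?thesis
      using True by simp
  next
    case False
    then have "Pair x -` U = {}"
      by (auto simp: U_def)
    then show ?thesis
      by simp
  qed
  have "emeasure lborel U = emeasure (lborel \<Otimes>\<^sub>M lborel) U"
    by (simp add: lborel_prod)
  also have "\<dots> = (\<integral>\<^sup>+x. emeasure lborel (Pair x -` U) \<partial>lborel)"
    by (rule lborel.emeasure_pair_measure_alt) (use U in \<open>simp only: lborel_prod\<close>)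
  also have "\<dots> \<le> (\<integral>\<^sup>+x. ennreal (?c * (real ?n * 4 ^ ?n * (4 * \<eta>))) * indicator (cball (0::'a) 2) x \<partial>lborel)"
    by (intro nn_integral_mono sec)
  also have "\<dots> = ennreal (?c * (real ?n * 4 ^ ?n * (4 * \<eta>))) * ennreal (unit_ball_vol DIM('a) * 2 ^ DIM('a))"
    by (subst nn_integral_cmult_indicator) (auto simp: emeasure_cball)
  also have "\<dots> = ennreal (unit_ball_vol DIM('a) * 2 ^ DIM('a) * (?c * (real ?n * 4 ^ ?n * 4)) * \<eta>)"
    using \<eta> by (simp add: ennreal_mult[symmetric] mult_ac)
  finally show "emeasure lborel U \<le> ennreal (unit_ball_vol DIM('a) * 2 ^ DIM('a) *
      (?c * (real ?n * 4 ^ ?n * 4)) * \<eta>)" .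
qed

text \<open>At a point within \<eta> of the truncated cone both factor norms are within \<eta> of a
  common value at most 1, so the point lies in the tube just measured.\<close>

lemma hausdorff_outer_cone_finite:
  fixes C :: "('a::euclidean_space \<times> 'b::euclidean_space) set"
  assumes "\<And>z. z \<in> C \<Longrightarrow> norm (fst z) = norm (snd z)" and "Suc k = DIM('a) + DIM('b)"
  shows "hausdorff_outer k (C \<inter> cball 0 1) < \<infinity>"
proof (rule hausdorff_outer_finite)
  fix \<eta> :: real
  assume \<eta>: "0 < \<eta>" "\<eta> \<le> 1"
  let ?U = "{z :: 'a \<times> 'b. norm (fst z) \<le> 2 \<and> \<bar>norm (fst z) - norm (snd z)\<bar> \<le> 2 * \<eta>}"
  have "ball a \<eta> \<subseteq> ?U" if a: "a \<in> C \<inter> cball 0 1" for a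
  proof
    fix z
    assume z: "z \<in> ball a \<eta>"
    have "norm (fst z - fst a) \<le> norm (z - a)" "norm (snd z - snd a) \<le> norm (z - a)"
      using norm_fst_le[of "fst (z - a)" "snd (z - a)"] norm_snd_le[of "snd (z - a)" "fst (z - a)"]
      unfolding prod.collapse by (simp_all only: fst_diff snd_diff)
    moreover have "norm (z - a) < \<eta>"
      using z by (simp add: dist_norm norm_minus_commute)
    moreover have "norm (fst a) = norm (snd a)" "norm (fst a) \<le> 1"
      using a assms(1)[of a] norm_fst_le[of "fst a" "snd a"] by auto
    moreover have "\<bar>norm (fst z) - norm (fst a)\<bar> \<le> norm (fst z - fst a)"
      "\<bar>norm (snd z) - norm (snd a)\<bar> \<le> norm (snd z - snd a)"
      by (rule norm_triangle_ineq3)+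
    ultimately have "norm (fst z) \<le> 2" "\<bar>norm (fst z) - norm (snd z)\<bar> \<le> 2 * \<eta>"
      using \<eta> by linarith+
    then show "z \<in> ?U"
      by simp
  qed
  then show "\<exists>U\<in>sets lborel. (\<Union>a\<in>C \<inter> cball 0 1. ball a \<eta>) \<subseteq> U \<and>
      emeasure lborel U \<le> ennreal (unit_ball_vol DIM('a) * 2 ^ DIM('a) *
        (unit_ball_vol DIM('b) * (real DIM('b) * 4 ^ DIM('b) * 4)) * \<eta>)"
    using emeasure_cone_tube[OF \<eta>] by (intro bexI[of _ ?U] conjI UN_least)
qed (use assms in auto)

section \<open>Exterior derivative of the potential\<close>

lemma bounded_bilinear_vol_form:
  fixes v :: "'a::euclidean_space list"
  assumes "Suc (Suc (length v)) = DIM('a)"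
  shows "bounded_bilinear (\<lambda>a b. vol_form (a # b # v))"
proof -
  have "linear (\<lambda>a. vol_form ((0 # b # v)[0 := a]))" for b
    by (rule vol_form_linear) (use assms in simp_all)
  moreover have "linear (\<lambda>b. vol_form ((a # 0 # v)[Suc 0 := b]))" for a
    by (rule vol_form_linear) (use assms in simp_all)
  ultimately show ?thesis
    by (simp add: bilinear_conv_bounded_bilinear[symmetric] bilinear_def)
qed

lemma vol_form_Cons_linear:
  fixes v :: "'a::euclidean_space list"
  assumes "Suc (length v) = DIM('a)"
  shows "linear (\<lambda>a. vol_form (a # v))"
  using vol_form_linear[of "0 # v" 0] assms by simp

text \<open>In the exterior derivative the \<open>i\<close>-th vector is removed from the list and
  reappears, differentiated, in one of the two leading slots. Moving that slot back to position
  \<open>i\<close> cancels the alternating sign up to a sign independent of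
  \<open>i\<close>.\<close>

lemma vol_form_move:
  fixes v :: "'a::euclidean_space list"
  assumes v: "Suc (length v) = DIM('a)" and i: "i < length v"
  shows "vol_form (c # b # take i v @ drop (Suc i) v) = (-1) ^ Suc i * vol_form (b # v[i := c])"
    and "vol_form (a # c # take i v @ drop (Suc i) v) = (-1) ^ i * vol_form (a # v[i := c])"
proof -
  let ?u = "take i v @ drop (Suc i) v"
  have len: "Suc (length (b # ?u)) = DIM('a)" for b
    using v i by simp
  have upd: "take (Suc i) (b # ?u) @ c # drop (Suc i) (b # ?u) = b # v[i := c]" for b
    using i by (simp add: upd_conv_take_nth_drop min_def)
  have *: "vol_form (b # v[i := c]) = (-1) ^ Suc i * vol_form (c # b # ?u)" for b
    using vol_form_insert[OF len, of "Suc i" b c] i unfolding upd by simp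
  have "vol_form (a # c # ?u) = - vol_form (c # a # ?u)"
    using vol_form_insert[OF len, of 1 a c] by simp
  then show "vol_form (a # c # ?u) = (-1) ^ i * vol_form (a # v[i := c])"
    by (simp add: *)
  show "vol_form (c # b # ?u) = (-1) ^ Suc i * vol_form (b # v[i := c])"
    by (simp add: *)
qed

text \<open>Since \<open>P\<close> kills the leading vector, the full trace identity has no term for
  it.\<close>

lemma vol_form_trace_Cons:
  fixes v :: "'a::euclidean_space list"
  assumes v: "Suc (length v) = DIM('a)" and P: "linear P" and b: "P b = 0"
  shows "(\<Sum>i<length v. vol_form (b # v[i := P (v ! i)])) = (\<Sum>e\<in>Basis. P e \<bullet> e) * vol_form (b # v)"
proof -
  have len: "length (b # v) = DIM('a)"
    using v by simp
  have "vol_form (0 # v) = 0"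
    using linear_0[OF vol_form_Cons_linear[OF v]] .
  then have "(\<Sum>i<Suc (length v). vol_form ((b # v)[i := P ((b # v) ! i)])) =
      (\<Sum>i<length v. vol_form (b # v[i := P (v ! i)]))"
    unfolding sum.lessThan_Suc_shift by (simp add: b)
  then show ?thesis
    using vol_form_trace[OF len P] unfolding v by simp
qed

text \<open>Cramer's rule with \<open>g\<close> written as an inner product; the term of the leading
  slot is moved to the right.\<close>

lemma vol_form_contract_Cons:
  fixes v :: "'a::euclidean_space list" and g :: "'a \<Rightarrow> real"
  assumes v: "Suc (length v) = DIM('a)" and g: "linear g"
  shows "(\<Sum>i<length v. g (v ! i) * vol_form (b # v[i := a])) =
    g a * vol_form (b # v) - g b * vol_form (a # v)"
proof -
  have len: "length (b # v) = DIM('a)"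
    using v by simp
  have l: "x \<bullet> adjoint g 1 = g x" for x
    using adjoint_works[OF g, of x 1] by simp
  have "(\<Sum>i<Suc (length v). g ((b # v) ! i) * vol_form ((b # v)[i := a])) = g a * vol_form (b # v)"
    using vol_form_contract[OF len, of "adjoint g 1" a] unfolding l v .
  then show ?thesis
    unfolding sum.lessThan_Suc_shift by simp
qed

lemma sum_Basis_prod:
  fixes g :: "'a::euclidean_space \<times> 'b::euclidean_space \<Rightarrow> real"
  shows "(\<Sum>e\<in>Basis. g e) = (\<Sum>i\<in>Basis. g (i, 0)) + (\<Sum>i\<in>Basis. g (0, i))"
proof -
  have "(\<lambda>u. (u, 0)) ` (Basis :: 'a set) \<inter> (\<lambda>u. (0, u)) ` (Basis :: 'b set) = {}"
    using nonzero_Basis by auto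
  then show ?thesis
    unfolding Basis_prod_def by (subst sum.union_disjoint) (auto simp: sum.reindex inj_on_def)
qed

text \<open>The volume form contracted with the bivector of the two radial fields, times
  \<open>f\<close>; its degree is two below the dimension, as the test forms for a hypersurface
  require.\<close>

definition potential ::
    "('a::euclidean_space \<times> 'b::euclidean_space \<Rightarrow> real) \<Rightarrow> ('a \<times> 'b) form" where
  "potential f z v = f z * vol_form ((fst z, 0) # (0, snd z) # v)"

text \<open>Differentiating the slot \<open>(x, 0)\<close> produces the trace of the first
  projection, differentiating \<open>(0, y)\<close> that of the second, hence the two dimensions;
  differentiating \<open>f\<close> produces a contraction with \<open>f'\<close>. The trace
  identities apply because each projection kills the other radial vector.\<close>

lemma ext_deriv_potential:
  fixes f :: "'a::euclidean_space \<times> 'b::euclidean_space \<Rightarrow> real"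
  assumes f: "(f has_derivative f') (at z)" and v: "Suc (length v) = DIM('a \<times> 'b)"
  shows "ext_deriv (potential f) z v = vol_form
    (((real DIM('b) * f z + f' (0, snd z)) *\<^sub>R fst z,
      - (real DIM('a) * f z + f' (fst z, 0)) *\<^sub>R snd z) # v)"
proof -
  define P where "P = (\<lambda>w :: 'a \<times> 'b. (fst w, 0 :: 'b))"
  define Q where "Q = (\<lambda>w :: 'a \<times> 'b. (0 :: 'a, snd w))"
  define a where "a = P z"
  define b where "b = Q z"
  have lin: "bounded_linear P" "bounded_linear Q"
    unfolding P_def Q_def by (intro bounded_linear_intros)+
  have PQ: "P b = 0" "Q a = 0"
    by (simp_all add: a_def b_def P_def Q_def zero_prod_def)
  have tr: "(\<Sum>e\<in>Basis. P e \<bullet> e) = real DIM('a)" "(\<Sum>e\<in>Basis. Q e \<bullet> e) = real DIM('b)"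
    by (simp_all add: P_def Q_def sum_Basis_prod)
  have f'_lin: "linear f'"
    using f has_derivative_linear by blast
  let ?u = "\<lambda>i. take i v @ drop (Suc i) v"
  have deriv: "frechet_derivative (\<lambda>y. potential f y (?u i)) (at z) h =
      f z * (vol_form (a # Q h # ?u i) + vol_form (P h # b # ?u i)) + f' h * vol_form (a # b # ?u i)"
    if "i < length v" for i h
  proof -
    have len: "Suc (Suc (length (?u i))) = DIM('a \<times> 'b)"
      using v that by simp
    interpret bounded_bilinear "\<lambda>a b. vol_form (a # b # ?u i)"
      by (rule bounded_bilinear_vol_form[OF len])
    have "((\<lambda>y. f y * vol_form (P y # Q y # ?u i)) has_derivative
        (\<lambda>h. f z * (vol_form (P z # Q h # ?u i) + vol_form (P h # Q z # ?u i)) +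
          f' h * vol_form (P z # Q z # ?u i))) (at z)"
      by (intro has_derivative_mult f FDERIV bounded_linear_imp_has_derivative lin)
    then show ?thesis
      unfolding potential_def P_def[symmetric] Q_def[symmetric] a_def b_def
      by (subst frechet_derivative_at[symmetric]) (simp_all add: P_def Q_def)
  qed
  have "ext_deriv (potential f) z v = (\<Sum>i<length v. (-1) ^ i *
      (f z * (vol_form (a # Q (v ! i) # ?u i) + vol_form (P (v ! i) # b # ?u i)) +
        f' (v ! i) * vol_form (a # b # ?u i)))"
    unfolding ext_deriv_def by (rule sum.cong) (simp_all add: deriv)
  also have "\<dots> = (\<Sum>i<length v.
      f z * vol_form (a # v[i := Q (v ! i)]) - f z * vol_form (b # v[i := P (v ! i)])
        - f' (v ! i) * vol_form (b # v[i := a]))"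
  proof (rule sum.cong)
    fix i
    assume "i \<in> {..<length v}"
    then have i: "i < length v"
      by simp
    have sq: "(-1 :: real) ^ i * ((-1) ^ i * x) = x" for x
      by (simp add: mult.assoc[symmetric] power_mult_distrib[symmetric])
    show "(-1) ^ i * (f z * (vol_form (a # Q (v ! i) # ?u i) + vol_form (P (v ! i) # b # ?u i)) +
        f' (v ! i) * vol_form (a # b # ?u i)) =
      f z * vol_form (a # v[i := Q (v ! i)]) - f z * vol_form (b # v[i := P (v ! i)])
        - f' (v ! i) * vol_form (b # v[i := a])"
      unfolding vol_form_move(2)[OF v i, of a "Q (v ! i)"] vol_form_move(1)[OF v i, of "P (v ! i)" b]
        vol_form_move(1)[OF v i, of a b]
      using sq[of "f z * vol_form (a # v[i := Q (v ! i)])"]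
        sq[of "f z * vol_form (b # v[i := P (v ! i)])"] sq[of "f' (v ! i) * vol_form (b # v[i := a])"]
      by (simp add: algebra_simps)
  qed simp
  also have "\<dots> = f z * (real DIM('b) * vol_form (a # v)) - f z * (real DIM('a) * vol_form (b # v))
      - (f' a * vol_form (b # v) - f' b * vol_form (a # v))"
    unfolding sum_subtractf sum_distrib_left[symmetric]
      vol_form_trace_Cons[OF v bounded_linear.linear[OF lin(1)] PQ(1)]
      vol_form_trace_Cons[OF v bounded_linear.linear[OF lin(2)] PQ(2)] tr
      vol_form_contract_Cons[OF v f'_lin] ..
  also have "\<dots> = (real DIM('b) * f z + f' b) * vol_form (a # v) - (real DIM('a) * f z + f' a) * vol_form (b # v)"
    by (simp add: algebra_simps)
  also have "\<dots> = vol_form (((real DIM('b) * f z + f' b) *\<^sub>R a - (real DIM('a) * f z + f' a) *\<^sub>R b) # v)"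
    by (simp add: linear_diff[OF vol_form_Cons_linear[OF v]] linear_scale[OF vol_form_Cons_linear[OF v]])
  also have "(real DIM('b) * f z + f' b) *\<^sub>R a - (real DIM('a) * f z + f' a) *\<^sub>R b =
      ((real DIM('b) * f z + f' (0, snd z)) *\<^sub>R fst z,
        - (real DIM('a) * f z + f' (fst z, 0)) *\<^sub>R snd z)"
    by (simp add: a_def b_def P_def Q_def algebra_simps)
  finally show ?thesis .
qed

lemma test_form_potential:
  fixes f :: "'a::euclidean_space \<times> 'b::euclidean_space \<Rightarrow> real"
  assumes f: "\<And>n. C_n n f" and supp: "\<And>z. norm z \<ge> R \<Longrightarrow> f z = 0"
    and k: "Suc (Suc k) = DIM('a \<times> 'b)"
  shows "test_form k (potential f)"
  unfolding test_form_def
proof (intro conjI allI impI)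
  show "covector k (potential f z)" for z
    unfolding covector_def
  proof (intro conjI allI impI)
    fix v :: "('a \<times> 'b) list" and i
    assume v: "length v = k" and i: "i < k"
    have "linear (\<lambda>w. vol_form (((fst z, 0) # (0, snd z) # v)[Suc (Suc i) := w]))"
      by (rule vol_form_linear) (use v i k in simp_all)
    from linear_compose_scale_right[OF this, of "f z"]
    show "linear (\<lambda>w. potential f z (v[i := w]))"
      by (simp add: potential_def)
  next
    fix v :: "('a \<times> 'b) list" and i j
    assume "length v = k" "i < j" "j < k" "v ! i = v ! j"
    then have "vol_form ((fst z, 0) # (0, snd z) # v) = 0"
      by (intro vol_form_identical[of "Suc (Suc i)" "Suc (Suc j)"]) (use k in simp_all)
    then show "potential f z v = 0"
      by (simp add: potential_def)
  qed
  show "C_n n (\<lambda>z. potential f z v)" if "length v = k" for v n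
    unfolding potential_def using that k
    by (intro C_n_mult f C_n_bilinear[OF bounded_bilinear_vol_form] bounded_linear_intros) simp
  show "\<exists>K. compact K \<and> (\<forall>z v. z \<notin> K \<longrightarrow> length v = k \<longrightarrow> potential f z v = 0)"
    by (intro exI[of _ "cball 0 R"]) (auto simp: potential_def supp)
qed

section \<open>The calibration\<close>

text \<open>The field dual to the exterior derivative of \<open>c s\<^bsup>\<beta>/2\<^esup> vol((x, 0), (0, y), \<dots>)\<close>, where
  \<open>s = \<bar>z\<bar>\<^sup>2 + \<epsilon>\<close>. It is harmless that \<open>0 powr (\<beta> / 2 - 1) = 0\<close>, since the field vanishes at
  the origin anyway.\<close>

definition calib :: "real \<Rightarrow> real \<Rightarrow> 'a::euclidean_space \<times> 'a \<Rightarrow> 'a \<times> 'a" where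
  "calib \<beta> s z =
    ((2 / (2 * real DIM('a) + \<beta>) * (real DIM('a) * s powr (\<beta> / 2) + \<beta> * s powr (\<beta> / 2 - 1) * (norm (snd z))\<^sup>2)) *\<^sub>R fst z,
     - (2 / (2 * real DIM('a) + \<beta>) * (real DIM('a) * s powr (\<beta> / 2) + \<beta> * s powr (\<beta> / 2 - 1) * (norm (fst z))\<^sup>2)) *\<^sub>R snd z)"

text \<open>A positive \<epsilon> keeps the base of the power away from 0, so the potential is
  smooth at the origin too. The cutoff is 1 near every point with norm below \<open>R\<close> and
  leaves the derivative there unchanged.\<close>

lemma calib_primitive:
  fixes \<beta> \<epsilon> R :: real
  assumes "R \<ge> 0" and "\<epsilon> > 0"
  obtains \<phi> :: "('a::euclidean_space \<times> 'a) form"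
  where "test_form (2 * DIM('a) - 2) \<phi>"
    and "\<And>z v. norm z < R \<Longrightarrow> Suc (length v) = 2 * DIM('a) \<Longrightarrow>
      ext_deriv \<phi> z v = vol_form (calib \<beta> ((norm z)\<^sup>2 + \<epsilon>) z # v)"
proof -
  obtain cut :: "'a \<times> 'a \<Rightarrow> real" where cut: "\<And>n. C_n n cut"
    "\<And>z. norm z \<le> R \<Longrightarrow> cut z = 1" "\<And>z. norm z \<ge> R + 1 \<Longrightarrow> cut z = 0"
    using smooth_cutoff[OF assms(1)] by blast
  define c where "c = 2 / (2 * real DIM('a) + \<beta>)"
  define g where "g z = c * (z \<bullet> z + \<epsilon>) powr (\<beta> / 2)" for z :: "'a \<times> 'a"
  define f where "f z = g z * cut z" for z
  have pos: "z \<bullet> z + \<epsilon> > 0" for z :: "'a \<times> 'a"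
    using assms(2) by (simp add: add_nonneg_pos)
  have smooth: "C_n n f" for n
    unfolding f_def g_def
    by (intro C_n_mult C_n_const C_n_powr pos C_n_add cut
        C_n_bilinear[OF bounded_bilinear_inner] bounded_linear_ident)
  have "test_form (2 * DIM('a) - 2) (potential f)"
  proof (rule test_form_potential[OF smooth])
    show "f z = 0" if "norm z \<ge> R + 1" for z
      using cut(3)[OF that] by (simp add: f_def)
    show "Suc (Suc (2 * DIM('a) - 2)) = DIM('a \<times> 'a)"
      unfolding DIM_prod using DIM_positive[where 'a = 'a] by linarith
  qed
  moreover have "ext_deriv (potential f) z v = vol_form (calib \<beta> ((norm z)\<^sup>2 + \<epsilon>) z # v)"
    if z: "norm z < R" and v: "Suc (length v) = 2 * DIM('a)" for z and v :: "('a \<times> 'a) list"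
  proof -
    let ?s = "z \<bullet> z + \<epsilon>"
    let ?f' = "\<lambda>h. c * (\<beta> / 2 * ?s powr (\<beta> / 2 - 1) * (2 * (z \<bullet> h)))"
    have "((\<lambda>z. z \<bullet> z + \<epsilon>) has_derivative (\<lambda>h. 2 * (z \<bullet> h))) (at z)"
      by (auto intro!: derivative_eq_intros simp: inner_commute)
    from has_derivative_compose[OF this
        has_real_derivative_powr[OF pos, unfolded has_field_derivative_def]]
    have "(g has_derivative ?f') (at z)"
      unfolding g_def by (rule has_derivative_mult_right)
    then have f': "(f has_derivative ?f') (at z)"
      by (rule has_derivative_transform_within_open[of _ _ _ UNIV "ball 0 R"])
        (use z cut(2) in \<open>auto simp: f_def\<close>)
    have fz: "f z = c * ?s powr (\<beta> / 2)"
      using z cut(2)[of z] by (simp add: f_def g_def)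
    have v': "Suc (length v) = DIM('a \<times> 'a)"
      using v by simp
    show ?thesis
      unfolding ext_deriv_potential[OF f' v'] fz dot_square_norm[of z] calib_def c_def[symmetric]
      by (simp add: inner_prod_def dot_square_norm algebra_simps)
  qed
  ultimately show thesis
    by (rule that)
qed

lemma power2_powr_half:
  fixes x :: real
  assumes "x \<ge> 0"
  shows "x\<^sup>2 powr (b / 2) = x powr b"
proof (cases "x = 0")
  case False
  then have "x\<^sup>2 = x powr 2"
    using assms by (simp add: powr_numeral)
  then show ?thesis
    by (simp add: powr_powr)
qed simp

text \<open>With \<open>u = |x|^2\<close>, \<open>w = |y|^2\<close>, \<open>s = u + w\<close>, the
  squared length is \<open>c^2 s^\<beta> (n^2 s + (4 n \<beta> + \<beta>^2) u w / s)\<close>. As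
  \<beta> is nonnegative, \<open>u w \<le> s^2 / 4\<close> may be inserted and completes the square
  \<open>(n + \<beta> / 2)^2 s\<close>, which \<open>c^2\<close> normalises.\<close>

lemma norm_calib_le_powr:
  fixes z :: "'a::euclidean_space \<times> 'a"
  assumes \<beta>: "\<beta> \<ge> 0"
  shows "norm (calib \<beta> ((norm z)\<^sup>2) z) \<le> norm z powr (\<beta> + 1)"
proof (cases "z = 0")
  case False
  define n where "n = real DIM('a)"
  define u where "u = (norm (fst z))\<^sup>2"
  define w where "w = (norm (snd z))\<^sup>2"
  define s where "s = (norm z)\<^sup>2"
  define t where "t = s powr (\<beta> / 2)"
  have n: "n > 0"
    by (simp add: n_def)
  have uw: "u \<ge> 0" "w \<ge> 0" "s > 0" "s = u + w"
    using False by (simp_all add: u_def w_def s_def) (simp add: norm_prod_def)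
  have s': "s powr (\<beta> / 2 - 1) = t / s"
    using uw by (simp add: t_def powr_diff)
  have fact: "2 / (2 * n + \<beta>) * (n * t + \<beta> * (t / s) * x) = 2 / (2 * n + \<beta>) * t * (n + \<beta> * x / s)" for x
    by (simp add: algebra_simps)
  have "(norm (calib \<beta> s z))\<^sup>2 =
      (2 / (2 * n + \<beta>) * (n * t + \<beta> * (t / s) * w))\<^sup>2 * u + (2 / (2 * n + \<beta>) * (n * t + \<beta> * (t / s) * u))\<^sup>2 * w"
    unfolding calib_def s' t_def[symmetric] n_def[symmetric] u_def w_def norm_prod_def fst_conv snd_conv
      norm_scaleR power_mult_distrib power2_abs abs_minus_cancel
    by (subst real_sqrt_pow2) (intro add_nonneg_nonneg mult_nonneg_nonneg zero_le_power2, rule refl)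
  also have "\<dots> = (2 / (2 * n + \<beta>))\<^sup>2 * t\<^sup>2 * ((n + \<beta> * w / s)\<^sup>2 * u + (n + \<beta> * u / s)\<^sup>2 * w)"
    unfolding fact power_mult_distrib by (simp only: distrib_left mult.assoc)
  also have "\<dots> \<le> (2 / (2 * n + \<beta>))\<^sup>2 * t\<^sup>2 * ((n + \<beta> / 2)\<^sup>2 * s)"
  proof (rule mult_left_mono)
    have "(n + \<beta> * w / s)\<^sup>2 * u + (n + \<beta> * u / s)\<^sup>2 * w = n\<^sup>2 * s + (4 * n * \<beta> + \<beta>\<^sup>2) * (u * w / s)"
    proof -
      have "(n + \<beta> * w / s)\<^sup>2 * u + (n + \<beta> * u / s)\<^sup>2 * w =
          n\<^sup>2 * (u + w) + 4 * n * \<beta> * (u * w / s) + \<beta>\<^sup>2 * (u * w / s) * ((u + w) / s)"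
        by (simp add: power2_eq_square algebra_simps add_divide_distrib)
      then show ?thesis
        using uw by (simp add: algebra_simps)
    qed
    also have "u * w / s \<le> s / 4"
    proof -
      have "4 * (u * w) \<le> s * s"
        using zero_le_square[of "u - w"] uw by (simp add: algebra_simps)
      then show ?thesis
        using uw by (simp add: pos_divide_le_eq)
    qed
    then have "n\<^sup>2 * s + (4 * n * \<beta> + \<beta>\<^sup>2) * (u * w / s) \<le> n\<^sup>2 * s + (4 * n * \<beta> + \<beta>\<^sup>2) * (s / 4)"
      using n \<beta> by (intro add_left_mono mult_left_mono) auto
    also have "\<dots> = (n + \<beta> / 2)\<^sup>2 * s"
      by (simp add: power2_eq_square algebra_simps)
    finally show "(n + \<beta> * w / s)\<^sup>2 * u + (n + \<beta> * u / s)\<^sup>2 * w \<le> (n + \<beta> / 2)\<^sup>2 * s" .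
  qed simp
  also have "\<dots> = t\<^sup>2 * s"
  proof -
    have "2 / (2 * n + \<beta>) * (n + \<beta> / 2) = 1"
      using n \<beta> by (simp add: field_simps)
    then have "(2 / (2 * n + \<beta>))\<^sup>2 * (n + \<beta> / 2)\<^sup>2 = 1"
      unfolding power_mult_distrib[symmetric] by simp
    then have "(2 / (2 * n + \<beta>))\<^sup>2 * (n + \<beta> / 2)\<^sup>2 * (t\<^sup>2 * s) = t\<^sup>2 * s"
      by simp
    then show ?thesis
      by (simp only: mult_ac)
  qed
  also have "\<dots> = (norm z powr (\<beta> + 1))\<^sup>2"
  proof -
    have "t = norm z powr \<beta>"
      by (simp add: t_def s_def power2_powr_half)
    then show ?thesis
      using False by (simp add: s_def powr_add power_mult_distrib)
  qed
  finally show ?thesis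
    unfolding s_def by (rule power2_le_imp_le) simp
qed (simp add: calib_def)

text \<open>A crude majorant for the regularised fields, meant for dominated convergence. Each
  coefficient is at most twice \<open>s powr (\<beta> / 2)\<close>, because
  \<open>(2 n + 2 \<beta>) / (2 n + \<beta>) \<le> 2\<close>; the two components give the factor
  4.\<close>

lemma norm_calib_bound:
  fixes z :: "'a::euclidean_space \<times> 'a"
  assumes \<beta>: "\<beta> \<ge> 0" and s: "(norm z)\<^sup>2 \<le> s" "s > 0"
  shows "norm (calib \<beta> s z) \<le> 4 * s powr (\<beta> / 2) * norm z"
proof -
  define n where "n = real DIM('a)"
  define t where "t = s powr (\<beta> / 2)"
  have n: "n > 0"
    by (simp add: n_def)
  have *: "\<bar>2 / (2 * n + \<beta>) * (n * t + \<beta> * s powr (\<beta> / 2 - 1) * (norm y)\<^sup>2)\<bar> \<le> 2 * t"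
    if "norm y \<le> norm z" for y :: 'a
  proof -
    have "s powr (\<beta> / 2 - 1) * (norm y)\<^sup>2 \<le> s powr (\<beta> / 2 - 1) * s"
      using that s by (intro mult_left_mono order_trans[OF power_mono s(1)]) auto
    also have "\<dots> = t"
      using s by (simp add: t_def powr_diff)
    finally have "\<beta> * (s powr (\<beta> / 2 - 1) * (norm y)\<^sup>2) \<le> \<beta> * t"
      using \<beta> by (rule mult_left_mono)
    then have "n * t + \<beta> * s powr (\<beta> / 2 - 1) * (norm y)\<^sup>2 \<le> (n + \<beta>) * t"
      by (simp add: algebra_simps)
    then have "2 / (2 * n + \<beta>) * (n * t + \<beta> * s powr (\<beta> / 2 - 1) * (norm y)\<^sup>2)
        \<le> 2 / (2 * n + \<beta>) * ((n + \<beta>) * t)"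
      using n \<beta> by (intro mult_left_mono) auto
    also have "\<dots> = (2 * n + 2 * \<beta>) / (2 * n + \<beta>) * t"
      by (simp only: times_divide_eq_left distrib_left mult.assoc mult_2 distrib_right add_divide_distrib)
    also have "\<dots> \<le> 2 * t"
      using n \<beta> by (intro mult_right_mono) (auto simp: t_def pos_divide_le_eq)
    finally have "2 / (2 * n + \<beta>) * (n * t + \<beta> * s powr (\<beta> / 2 - 1) * (norm y)\<^sup>2) \<le> 2 * t" .
    moreover have "0 \<le> 2 / (2 * n + \<beta>) * (n * t + \<beta> * s powr (\<beta> / 2 - 1) * (norm y)\<^sup>2)"
      using n \<beta> by (auto simp: t_def intro!: mult_nonneg_nonneg add_nonneg_nonneg)
    ultimately show ?thesis
      by (simp only: abs_of_nonneg)
  qed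
  have le: "norm (fst z) \<le> norm z" "norm (snd z) \<le> norm z"
    using norm_fst_le[of "fst z" "snd z"] norm_snd_le[of "snd z" "fst z"] by simp_all
  have "norm (calib \<beta> s z) \<le> norm (fst (calib \<beta> s z)) + norm (snd (calib \<beta> s z))"
    using norm_Pair_le[of "fst (calib \<beta> s z)" "snd (calib \<beta> s z)"] by simp
  also have "\<dots> \<le> 2 * t * norm (fst z) + 2 * t * norm (snd z)"
    unfolding calib_def fst_conv snd_conv norm_scaleR abs_minus_cancel n_def[symmetric] t_def[symmetric]
    by (intro add_mono mult_right_mono * le) auto
  also have "\<dots> \<le> 2 * t * norm z + 2 * t * norm z"
    using le by (intro add_mono mult_left_mono) (auto simp: t_def)
  finally show ?thesis
    by (simp add: t_def mult_ac)
qed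

text \<open>Equality case: on the cone both squared factor norms are \<open>s / 2\<close>, and the
  two coefficients coincide.\<close>

lemma calib_cone:
  fixes z :: "'a::euclidean_space \<times> 'a"
  assumes \<beta>: "\<beta> \<ge> 0" and z: "norm (fst z) = norm (snd z)"
  shows "calib \<beta> ((norm z)\<^sup>2) z = norm z powr \<beta> *\<^sub>R (fst z, - snd z)"
proof (cases "z = 0")
  case False
  define n where "n = real DIM('a)"
  define s where "s = (norm z)\<^sup>2"
  have n: "n > 0"
    by (simp add: n_def)
  have s: "s > 0" "(norm (snd z))\<^sup>2 = s / 2"
    using False z by (simp add: s_def) (simp add: s_def z norm_prod_def)
  have t: "s powr (\<beta> / 2) = norm z powr \<beta>"
    by (simp add: s_def power2_powr_half)
  have "2 / (2 * n + \<beta>) * (n * s powr (\<beta> / 2) + \<beta> * s powr (\<beta> / 2 - 1) * (s / 2)) =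
      2 / (2 * n + \<beta>) * (n + \<beta> / 2) * s powr (\<beta> / 2)"
  proof -
    have "s powr (\<beta> / 2 - 1) * (s / 2) = s powr (\<beta> / 2) / 2"
      using s by (simp add: powr_diff)
    moreover have "c * (n * T + \<beta> * (T / 2)) = c * (n + \<beta> / 2) * T" for c T
      by (simp add: algebra_simps)
    ultimately show ?thesis
      by (simp only: mult.assoc)
  qed
  also have "2 / (2 * n + \<beta>) * (n + \<beta> / 2) = 1"
    using n \<beta> by (simp add: field_simps)
  finally have "2 / (2 * n + \<beta>) * (n * s powr (\<beta> / 2) + \<beta> * s powr (\<beta> / 2 - 1) * (s / 2)) = norm z powr \<beta>"
    by (simp add: t)
  then show ?thesis
    unfolding calib_def z s_def[symmetric] s(2) n_def[symmetric] by simp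
qed (simp add: calib_def)

text \<open>At the origin the power may be singular, but the vector factors vanish there for every
  \<open>s\<close>; elsewhere the limiting base is positive.\<close>

lemma calib_tendsto:
  "(\<lambda>j. calib \<beta> ((norm z)\<^sup>2 + 1 / real (Suc j)) z) \<longlonglongrightarrow> calib \<beta> ((norm z)\<^sup>2) z"
proof (cases "z = 0")
  case False
  have "(\<lambda>j. (norm z)\<^sup>2 + 1 / real (Suc j)) \<longlonglongrightarrow> (norm z)\<^sup>2 + 0"
    by (intro tendsto_intros LIMSEQ_Suc lim_const_over_n)
  then have s: "(\<lambda>j. (norm z)\<^sup>2 + 1 / real (Suc j)) \<longlonglongrightarrow> (norm z)\<^sup>2"
    by simp
  show ?thesis
    unfolding calib_def by (intro tendsto_intros s) (use False in auto)
qed (simp add: calib_def)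

lemma continuous_calib:
  assumes "\<epsilon> > 0"
  shows "continuous_on UNIV (\<lambda>z. calib \<beta> ((norm z)\<^sup>2 + \<epsilon>) z)"
proof -
  have "(norm z)\<^sup>2 + \<epsilon> \<noteq> 0" for z :: "'a \<times> 'a"
    using assms by (simp add: add_nonneg_pos order_less_imp_not_eq2)
  then show ?thesis
    unfolding calib_def by (intro continuous_intros) auto
qed

section \<open>Flux of the calibration through a current\<close>

lemma borel_measurable_hausdorff:
  fixes f :: "'a::euclidean_space \<Rightarrow> 'b::topological_space"
  assumes "f \<in> borel_measurable borel"
  shows "f \<in> borel_measurable (hausdorff k)"
proof (rule measurableI)
  fix A :: "'b set"
  assume "A \<in> sets borel"
  then show "f -` A \<inter> space (hausdorff k) \<in> sets (hausdorff k)"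
    using measurable_sets[OF assms, of A] by (intro borel_in_sets_hausdorff) (simp add: space_hausdorff)
qed simp

lemma hausdorff_outer_singleton:
  assumes "k \<ge> 1"
  shows "hausdorff_outer k {a :: 'a::euclidean_space} = 0"
proof -
  have "(INF C\<in>hausdorff_covers \<delta> {a}. \<Sum>i. hausdorff_size k (C i)) = 0" if "\<delta> > 0" for \<delta>
  proof -
    let ?C = "\<lambda>i::nat. {a}"
    have "?C \<in> hausdorff_covers \<delta> {a}"
      using that by (simp add: hausdorff_covers_def)
    then have "(INF C\<in>hausdorff_covers \<delta> {a}. \<Sum>i. hausdorff_size k (C i)) \<le> (\<Sum>i. hausdorff_size k (?C i))"
      by (rule INF_lower)
    also have "\<dots> = 0"
      using assms by (simp add: hausdorff_size_def power_0_left)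
    finally show ?thesis
      by simp
  qed
  then show ?thesis
    by (simp add: hausdorff_outer_def)
qed

lemma vol_form_Cons_covector:
  assumes "Suc k = DIM('a::euclidean_space)"
  shows "covector k (\<lambda>v. vol_form ((b :: 'a) # v))"
  unfolding covector_def
proof (intro conjI allI impI)
  fix v :: "'a list" and i
  assume "length v = k" "i < k"
  then show "linear (\<lambda>w. vol_form (b # v[i := w]))"
    using vol_form_linear[of "b # v" "Suc i"] assms by simp
next
  fix v :: "'a list" and i j
  assume "length v = k" "i < j" "j < k" "v ! i = v ! j"
  then show "vol_form (b # v) = 0"
    using assms by (intro vol_form_identical[of "Suc i" "Suc j"]) simp_all
qed

lemma vol_form_Cons_expand:
  fixes v :: "'a::euclidean_space list"
  assumes "Suc (length v) = DIM('a)"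
  shows "vol_form (x # v) = (\<Sum>b\<in>Basis. (x \<bullet> b) * vol_form (b # v))"
proof -
  interpret linear "\<lambda>a. vol_form (a # v)"
    by (rule vol_form_Cons_linear[OF assms])
  have "vol_form (x # v) = vol_form ((\<Sum>b\<in>Basis. (x \<bullet> b) *\<^sub>R b) # v)"
    by (simp add: euclidean_representation)
  then show ?thesis
    by (simp add: sum scale)
qed

text \<open>The orientation is known to be measurable only after pairing with constant covectors.
  Expanding the varying vector \<open>X x\<close> in the basis leaves a finite sum of such pairings
  with measurable coefficients.\<close>

lemma set_borel_measurable_vol_form:
  fixes X :: "'a::euclidean_space \<Rightarrow> 'a" and m :: "'a \<Rightarrow> real"
  assumes k: "Suc k = DIM('a)"
    and X: "continuous_on UNIV X"
    and m: "set_borel_measurable (hausdorff k) E m"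
    and len: "\<And>x. x \<in> E \<Longrightarrow> length (\<tau> x) = k"
    and \<tau>: "\<And>\<phi>. covector k \<phi> \<Longrightarrow> set_borel_measurable (hausdorff k) E (\<lambda>x. \<phi> (\<tau> x))"
  shows "set_borel_measurable (hausdorff k) E (\<lambda>x. m x * vol_form (X x # \<tau> x))"
proof -
  have X': "(\<lambda>x. X x \<bullet> b) \<in> borel_measurable (hausdorff k)" for b
    using X by (intro borel_measurable_hausdorff borel_measurable_continuous_onI continuous_intros)
  have \<tau>': "(\<lambda>x. indicator E x *\<^sub>R vol_form (b # \<tau> x)) \<in> borel_measurable (hausdorff k)" for b
    using \<tau>[OF vol_form_Cons_covector[OF k], of b] by (simp add: set_borel_measurable_def)
  have m': "(\<lambda>x. indicator E x *\<^sub>R m x) \<in> borel_measurable (hausdorff k)"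
    using m by (simp add: set_borel_measurable_def)
  have "(\<lambda>x. indicator E x *\<^sub>R (m x * vol_form (X x # \<tau> x))) =
      (\<lambda>x. (indicator E x *\<^sub>R m x) * (\<Sum>b\<in>Basis. (X x \<bullet> b) * (indicator E x *\<^sub>R vol_form (b # \<tau> x))))"
  proof
    fix x
    show "indicator E x *\<^sub>R (m x * vol_form (X x # \<tau> x)) =
        (indicator E x *\<^sub>R m x) * (\<Sum>b\<in>Basis. (X x \<bullet> b) * (indicator E x *\<^sub>R vol_form (b # \<tau> x)))"
      using len[of x] k by (cases "x \<in> E") (simp_all add: vol_form_Cons_expand[of "\<tau> x"])
  qed
  then show ?thesis
    unfolding set_borel_measurable_def
    by (simp only:) (intro borel_measurable_times borel_measurable_sum X' \<tau>' m')
qed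

definition flux :: "nat \<Rightarrow> real \<Rightarrow> ('a::euclidean_space \<times> 'a) rect_data \<Rightarrow> real" where
  "flux k \<beta> S = current k S (\<lambda>z v. vol_form (calib \<beta> ((norm z)\<^sup>2) z # v))"

text \<open>What the integration of forms uses, shared by the competitor and by the cone without its
  apex.\<close>

definition finite_mass_data :: "nat \<Rightarrow> 'a::euclidean_space rect_data \<Rightarrow> bool" where
  "finite_mass_data k S \<longleftrightarrow>
     carr S \<in> sets (hausdorff k) \<and> bounded (carr S) \<and>
     set_borel_measurable (hausdorff k) (carr S) (\<lambda>x. real (mult S x)) \<and>
     (\<integral>\<^sup>+x\<in>carr S. ennreal (real (mult S x)) \<partial>hausdorff k) < \<infinity> \<and>
     (\<forall>x\<in>carr S. orthonormal_frame k (orient S x)) \<and>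
     (\<forall>\<phi>. covector k \<phi> \<longrightarrow>
        set_borel_measurable (hausdorff k) (carr S) (\<lambda>x. \<phi> (orient S x)))"

lemma flux_limit:
  fixes S :: "('a::euclidean_space \<times> 'a) rect_data"
  assumes k: "Suc k = DIM('a \<times> 'a)" and \<beta>: "\<beta> \<ge> 0" and S: "finite_mass_data k S"
  shows "set_integrable (hausdorff k) (carr S)
      (\<lambda>z. real (mult S z) * vol_form (calib \<beta> ((norm z)\<^sup>2) z # orient S z))" (is ?int)
    and "(\<lambda>j. current k S (\<lambda>z v. vol_form (calib \<beta> ((norm z)\<^sup>2 + 1 / real (Suc j)) z # v)))
      \<longlonglongrightarrow> flux k \<beta> S" (is ?lim)
proof -
  let ?H = "hausdorff k :: ('a \<times> 'a) measure" and ?E = "carr S"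
  have E: "?E \<in> sets ?H" and frame: "\<And>z. z \<in> ?E \<Longrightarrow> orthonormal_frame k (orient S z)"
    and m: "set_borel_measurable ?H ?E (\<lambda>x. real (mult S x))"
    and fin: "(\<integral>\<^sup>+x\<in>?E. ennreal (real (mult S x)) \<partial>?H) < \<infinity>"
    and ori: "\<And>\<phi>. covector k \<phi> \<Longrightarrow> set_borel_measurable ?H ?E (\<lambda>x. \<phi> (orient S x))"
    using S by (auto simp: finite_mass_data_def)
  have len: "length (orient S z) = k" if "z \<in> ?E" for z
    using frame[OF that] by (simp add: orthonormal_frame_def)
  obtain R where R: "R \<ge> 0" "\<And>z. z \<in> ?E \<Longrightarrow> norm z \<le> R"
    using S by (auto simp: finite_mass_data_def bounded_pos intro: less_imp_le)
  \<comment> \<open>The value of the crude bound for \<open>norm z \<le> R\<close> and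
    \<open>s \<le> R^2 + 1\<close>, valid for all \<open>j\<close> at once; \<open>M\<close> times
    the multiplicity is integrable because the mass is finite.\<close>
  define M where "M = 4 * (R\<^sup>2 + 1) powr (\<beta> / 2) * R"
  define G where "G s z = indicator ?E z *\<^sub>R (real (mult S z) * vol_form (calib \<beta> s z # orient S z))" for s z
  define g where "g j z = G ((norm z)\<^sup>2 + 1 / real (Suc j)) z" for j z
  define h where "h z = G ((norm z)\<^sup>2) z" for z
  have meas: "g j \<in> borel_measurable ?H" for j
  proof -
    have "continuous_on UNIV (\<lambda>z :: 'a \<times> 'a. calib \<beta> ((norm z)\<^sup>2 + 1 / real (Suc j)) z)"
      by (rule continuous_calib) simp
    from set_borel_measurable_vol_form[where \<tau> = "orient S", OF k this m len ori]
    show ?thesis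
      by (simp add: set_borel_measurable_def g_def[abs_def] G_def)
  qed
  have lim: "(\<lambda>j. g j z) \<longlonglongrightarrow> h z" for z
  proof (cases "z \<in> ?E")
    case True
    have "Suc (length (orient S z)) = DIM('a \<times> 'a)"
      using len[OF True] k by simp
    from linear_continuous_at[OF linear_conv_bounded_linear[THEN iffD1, OF vol_form_Cons_linear[OF this]]]
    have "isCont (\<lambda>a. vol_form (a # orient S z)) (calib \<beta> ((norm z)\<^sup>2) z)" .
    from isCont_tendsto_compose[OF this calib_tendsto]
    show ?thesis
      unfolding g_def h_def G_def by (intro tendsto_intros)
  qed (simp add: g_def h_def G_def)
  \<comment> \<open>The limit field inherits measurability from the regularised ones, which are
    continuous.\<close>
  have meas_h: "h \<in> borel_measurable ?H"
    by (rule borel_measurable_LIMSEQ_real[OF lim meas])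
  have int: "integrable ?H (\<lambda>z. M * (indicator ?E z *\<^sub>R real (mult S z)))"
  proof (intro integrable_mult_right)
    show "integrable ?H (\<lambda>z. indicator ?E z *\<^sub>R real (mult S z))"
    proof (rule integrableI_nonneg)
      have "(\<integral>\<^sup>+z. ennreal (indicator ?E z *\<^sub>R real (mult S z)) \<partial>?H) = (\<integral>\<^sup>+x\<in>?E. ennreal (real (mult S x)) \<partial>?H)"
        by (rule nn_integral_cong) (simp add: indicator_def)
      then show "(\<integral>\<^sup>+z. ennreal (indicator ?E z *\<^sub>R real (mult S z)) \<partial>?H) < \<infinity>"
        using fin by simp
    qed (use m in \<open>auto simp: set_borel_measurable_def\<close>)
  qed
  have bound: "norm (g j z) \<le> M * (indicator ?E z *\<^sub>R real (mult S z))" for j z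
  proof (cases "z \<in> ?E")
    case True
    let ?s = "(norm z)\<^sup>2 + 1 / real (Suc j)"
    have s: "?s > 0" "?s \<le> R\<^sup>2 + 1"
      using R(2)[OF True] by (auto intro!: add_nonneg_pos add_mono power_mono)
    have "\<bar>vol_form (calib \<beta> ?s z # orient S z)\<bar> \<le> norm (calib \<beta> ?s z)"
      by (rule vol_form_Cons_le[OF frame[OF True] k])
    also have "\<dots> \<le> 4 * ?s powr (\<beta> / 2) * norm z"
      by (rule norm_calib_bound[OF \<beta> _ s(1)]) simp
    also have "\<dots> \<le> M"
      unfolding M_def using s \<beta> R(2)[OF True] by (intro mult_mono powr_mono2 mult_left_mono) auto
    finally have "real (mult S z) * \<bar>vol_form (calib \<beta> ?s z # orient S z)\<bar> \<le> real (mult S z) * M"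
      by (rule mult_left_mono) simp
    then show ?thesis
      using True by (simp add: g_def G_def abs_mult mult.commute)
  qed (simp add: g_def G_def)
  have *: "integrable ?H h" "(\<lambda>j. integral\<^sup>L ?H (g j)) \<longlonglongrightarrow> integral\<^sup>L ?H h"
    using integrable_dominated_convergence[where s = g, OF meas_h meas int]
      integral_dominated_convergence[where s = g, OF meas_h meas int] lim bound by simp_all
  show ?int
    using *(1) by (simp add: set_integrable_def h_def[abs_def] G_def)
  show ?lim
    using *(2) by (simp add: flux_def current_def set_lebesgue_integral_def g_def[abs_def] h_def[abs_def] G_def)
qed

lemma flux_eqI:
  fixes S T :: "('a::euclidean_space \<times> 'a) rect_data"
  assumes k: "Suc k = DIM('a \<times> 'a)" and \<beta>: "\<beta> \<ge> 0"
    and S: "finite_mass_data k S" and T: "finite_mass_data k T"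
    and eq: "\<And>\<phi>. test_form (k - 1) \<phi> \<Longrightarrow> boundary (current k S) \<phi> = boundary (current k T) \<phi>"
  shows "flux k \<beta> S = flux k \<beta> T"
proof -
  \<comment> \<open>One ball contains both carriers, so the same test form serves both currents; the
    inequality is strict because the primitive has the right derivative only inside the open
    ball.\<close>
  have "bounded (carr S \<union> carr T)"
    using S T by (simp add: finite_mass_data_def)
  then obtain R where "R > 0" and R: "\<And>z. z \<in> carr S \<union> carr T \<Longrightarrow> norm z < R"
    unfolding bounded_pos_less by blast
  have k1: "2 * DIM('a) - 2 = k - 1"
    using k by simp
  have "current k S (\<lambda>z v. vol_form (calib \<beta> ((norm z)\<^sup>2 + 1 / real (Suc j)) z # v)) =
      current k T (\<lambda>z v. vol_form (calib \<beta> ((norm z)\<^sup>2 + 1 / real (Suc j)) z # v))" for j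
  proof -
    obtain \<phi> :: "('a \<times> 'a) form" where \<phi>: "test_form (2 * DIM('a) - 2) \<phi>"
      "\<And>z v. norm z < R \<Longrightarrow> Suc (length v) = 2 * DIM('a) \<Longrightarrow>
        ext_deriv \<phi> z v = vol_form (calib \<beta> ((norm z)\<^sup>2 + 1 / real (Suc j)) z # v)"
      using calib_primitive[of R "1 / real (Suc j)" \<beta>] \<open>R > 0\<close> by (auto simp del: of_nat_Suc)
    have "current k U (ext_deriv \<phi>) =
        current k U (\<lambda>z v. vol_form (calib \<beta> ((norm z)\<^sup>2 + 1 / real (Suc j)) z # v))"
      if U: "finite_mass_data k U" "carr U \<subseteq> carr S \<union> carr T" for U
      unfolding current_def
    proof (rule set_lebesgue_integral_cong)
      show "carr U \<in> sets (hausdorff k)"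
        using U by (simp add: finite_mass_data_def)
      show "\<forall>z. z \<in> carr U \<longrightarrow> real (mult U z) * ext_deriv \<phi> z (orient U z) =
          real (mult U z) * vol_form (calib \<beta> ((norm z)\<^sup>2 + 1 / real (Suc j)) z # orient U z)"
      proof (intro allI impI)
        fix z
        assume z: "z \<in> carr U"
        then have "length (orient U z) = k"
          using U(1) by (simp add: finite_mass_data_def orthonormal_frame_def)
        moreover have "norm z < R"
          using z U(2) R by blast
        ultimately show "real (mult U z) * ext_deriv \<phi> z (orient U z) =
            real (mult U z) * vol_form (calib \<beta> ((norm z)\<^sup>2 + 1 / real (Suc j)) z # orient U z)"
          using \<phi>(2)[of z "orient U z"] k by simp
      qed
    qed
    from this[OF S] this[OF T] show ?thesis
      using eq[of \<phi>] \<phi>(1) by (simp add: boundary_def k1)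
  qed
  then show ?thesis
    using LIMSEQ_unique[OF flux_limit(2)[OF k \<beta> S]] flux_limit(2)[OF k \<beta> T] by simp
qed

text \<open>No constant may be lost here: \<open>flux\<close> is taken with
  \<open>s = |z|^2\<close>, where the sharp length bound holds.\<close>

lemma flux_le_weighted_mass:
  fixes S :: "('a::euclidean_space \<times> 'a) rect_data"
  assumes k: "Suc k = DIM('a \<times> 'a)" and \<beta>: "\<beta> \<ge> 0" and S: "finite_mass_data k S"
  shows "ennreal \<bar>flux k \<beta> S\<bar> \<le> weighted_mass k (\<lambda>z. norm z powr (\<beta> + 1)) S"
proof -
  let ?g = "\<lambda>z. indicator (carr S) z *\<^sub>R
    (real (mult S z) * vol_form (calib \<beta> ((norm z)\<^sup>2) z # orient S z))"
  have "ennreal \<bar>flux k \<beta> S\<bar> = ennreal (norm (integral\<^sup>L (hausdorff k) ?g))"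
    by (simp add: flux_def current_def set_lebesgue_integral_def)
  also have "\<dots> \<le> (\<integral>\<^sup>+z. ennreal (norm (?g z)) \<partial>hausdorff k)"
    using flux_limit(1)[OF k \<beta> S] unfolding set_integrable_def by (rule integral_norm_bound_ennreal)
  also have "\<dots> \<le> weighted_mass k (\<lambda>z. norm z powr (\<beta> + 1)) S"
    unfolding weighted_mass_def
  proof (rule nn_integral_mono)
    fix z
    show "ennreal (norm (?g z)) \<le> ennreal (norm z powr (\<beta> + 1) * real (mult S z)) * indicator (carr S) z"
    proof (cases "z \<in> carr S")
      case True
      then have "orthonormal_frame k (orient S z)"
        using S by (simp add: finite_mass_data_def)
      from order_trans[OF vol_form_Cons_le[OF this k] norm_calib_le_powr[OF \<beta>, of z]]
      show ?thesis
        using True by (auto simp: abs_mult mult.commute intro!: ennreal_leI mult_left_mono)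
    qed simp
  qed
  finally show ?thesis .
qed

section \<open>The cone over a product of spheres\<close>

definition norm_cone :: "('a::euclidean_space \<times> 'a) set" where
  "norm_cone = {z. norm (fst z) = norm (snd z)}"

text \<open>Half the gradient of \<open>|x|^2 - |y|^2\<close>, hence normal to the cone.\<close>

definition conormal :: "'a::euclidean_space \<times> 'a \<Rightarrow> 'a \<times> 'a" where
  "conormal z = (fst z, - snd z)"

lemma norm_conormal: "norm (conormal z) = norm z"
  by (simp add: conormal_def norm_prod_def)

lemma linear_conormal: "linear conormal"
  by (rule linearI) (simp_all add: conormal_def)

lemma conormal_inner_commute: "conormal x \<bullet> y = conormal y \<bullet> x"
  by (simp add: conormal_def inner_prod_def inner_commute)

lemma norm_cone_iff: "z \<in> norm_cone \<longleftrightarrow> conormal z \<bullet> z = 0"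
  by (simp add: norm_cone_def conormal_def inner_prod_def dot_square_norm)

lemma closed_norm_cone: "closed norm_cone"
  unfolding norm_cone_def by (intro closed_Collect_eq continuous_intros)

text \<open>Polar coordinates exhibit the punctured cone as the image of a half-line times two unit
  spheres, which are connected from dimension 2 of the factors on. This is how
  \<open>p \<ge> 1\<close> enters.\<close>

lemma connected_norm_cone:
  assumes "2 \<le> DIM('a::euclidean_space)"
  shows "connected (norm_cone - {0} :: ('a \<times> 'a) set)"
proof -
  let ?f = "\<lambda>(r :: real, u :: 'a, v :: 'a). (r *\<^sub>R u, r *\<^sub>R v)"
  let ?D = "{0<..} \<times> sphere (0 :: 'a) 1 \<times> sphere (0 :: 'a) 1"
  have "connected (?f ` ?D)"
    using assms
    by (intro connected_continuous_image connected_Times connected_sphere)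
      (auto simp: case_prod_unfold intro!: continuous_intros)
  also have "?f ` ?D = norm_cone - {0}"
  proof (intro equalityI subsetI)
    fix z
    assume z: "z \<in> norm_cone - {0 :: 'a \<times> 'a}"
    let ?r = "norm (fst z)"
    have r: "?r > 0" "norm (snd z) = ?r"
      using z by (auto simp: norm_cone_def prod_eq_iff)
    have "z = ?f (?r, fst z /\<^sub>R ?r, snd z /\<^sub>R ?r)"
      using r by (simp add: prod_eq_iff)
    moreover have "(?r, fst z /\<^sub>R ?r, snd z /\<^sub>R ?r) \<in> ?D"
      using r by simp
    ultimately show "z \<in> ?f ` ?D"
      by (rule image_eqI)
  qed (auto simp: norm_cone_def prod_eq_iff)
  finally show ?thesis .
qed

text \<open>The quadratic form \<open>conormal z \<bullet> z\<close> vanishes at \<open>x\<close>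
  and at \<open>a\<close>, so polarisation makes \<open>conormal a \<bullet> (x - a)\<close>
  quadratic in \<open>x - a\<close>. After scaling by \<open>r\<close> one factor stays bounded near
  \<open>v\<close> and the other is still small.\<close>

lemma tangent_cone_norm_cone:
  fixes a :: "'a::euclidean_space \<times> 'a"
  assumes a: "a \<in> norm_cone" and v: "v \<in> tangent_cone (norm_cone - {0}) a"
  shows "v \<bullet> conormal a = 0"
proof (rule ccontr)
  assume "v \<bullet> conormal a \<noteq> 0"
  then have d: "\<bar>conormal a \<bullet> v\<bar> > 0"
    by (simp add: inner_commute)
  \<comment> \<open>\<open>K\<close> is the factor of \<epsilon> in the estimate below, and
    \<epsilon> is chosen so that the estimate bounds a positive number by its half.\<close>
  define K where "K = norm a + (norm v + 1) / 2"
  define \<epsilon> where "\<epsilon> = min 1 (\<bar>conormal a \<bullet> v\<bar> / (2 * (K + 1)))"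
  have K: "K \<ge> 0"
    by (simp add: K_def)
  have \<epsilon>: "0 < \<epsilon>" "\<epsilon> \<le> 1" "\<epsilon> \<le> \<bar>conormal a \<bullet> v\<bar> / (2 * (K + 1))"
    using d K by (auto simp: \<epsilon>_def)
  obtain x r where x: "x \<in> norm_cone" and r: "r > 0"
    and near: "norm (x - a) < \<epsilon>" "norm (r *\<^sub>R (x - a) - v) < \<epsilon>"
    using v \<epsilon>(1) unfolding tangent_cone_def by blast
  have "conormal x \<bullet> x = 0" "conormal a \<bullet> a = 0"
    using x a by (simp_all add: norm_cone_iff)
  then have "2 * (conormal a \<bullet> (x - a)) = - (conormal (x - a) \<bullet> (x - a))"
    using conormal_inner_commute[of x a]
    by (simp add: linear_diff[OF linear_conormal] inner_diff_left inner_diff_right)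
  then have "conormal a \<bullet> (x - a) = - (conormal (x - a) \<bullet> (x - a)) / 2"
    by simp
  then have "conormal a \<bullet> (r *\<^sub>R (x - a)) = - (conormal (x - a) \<bullet> (r *\<^sub>R (x - a))) / 2"
    by (simp only: inner_scaleR_right)
  then have eq: "conormal a \<bullet> v = - (conormal (x - a) \<bullet> (r *\<^sub>R (x - a))) / 2 - conormal a \<bullet> (r *\<^sub>R (x - a) - v)"
    by (simp add: inner_diff_right)
  have "\<bar>conormal a \<bullet> v\<bar> \<le> \<bar>conormal (x - a) \<bullet> (r *\<^sub>R (x - a))\<bar> / 2 + \<bar>conormal a \<bullet> (r *\<^sub>R (x - a) - v)\<bar>"
    unfolding eq by linarith
  also have "\<dots> \<le> \<epsilon> * (norm v + 1) / 2 + norm a * \<epsilon>"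
  proof (intro add_mono divide_right_mono)
    have "norm (r *\<^sub>R (x - a)) \<le> norm v + norm (r *\<^sub>R (x - a) - v)"
      by (rule norm_triangle_sub)
    then have "norm (r *\<^sub>R (x - a)) \<le> norm v + 1"
      using near(2) \<epsilon>(2) by linarith
    then have "norm (conormal (x - a)) * norm (r *\<^sub>R (x - a)) \<le> \<epsilon> * (norm v + 1)"
      unfolding norm_conormal using near(1) \<epsilon>(1) by (intro mult_mono) auto
    then show "\<bar>conormal (x - a) \<bullet> (r *\<^sub>R (x - a))\<bar> \<le> \<epsilon> * (norm v + 1)"
      using Cauchy_Schwarz_ineq2 order_trans by blast
    have "\<bar>conormal a \<bullet> (r *\<^sub>R (x - a) - v)\<bar> \<le> norm (conormal a) * norm (r *\<^sub>R (x - a) - v)"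
      by (rule Cauchy_Schwarz_ineq2)
    also have "\<dots> \<le> norm a * \<epsilon>"
      unfolding norm_conormal using near(2) by (intro mult_left_mono) auto
    finally show "\<bar>conormal a \<bullet> (r *\<^sub>R (x - a) - v)\<bar> \<le> norm a * \<epsilon>" .
  qed simp
  also have "\<dots> = \<epsilon> * K"
    by (simp add: K_def algebra_simps add_divide_distrib)
  also have "\<dots> \<le> \<bar>conormal a \<bullet> v\<bar> / (2 * (K + 1)) * K"
    using \<epsilon>(3) K by (rule mult_right_mono)
  also have "\<dots> \<le> \<bar>conormal a \<bullet> v\<bar> / 2"
  proof -
    have "K / (K + 1) \<le> 1"
      using K by simp
    then have "\<bar>conormal a \<bullet> v\<bar> / 2 * (K / (K + 1)) \<le> \<bar>conormal a \<bullet> v\<bar> / 2 * 1"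
      by (intro mult_left_mono) simp_all
    then show ?thesis
      by simp
  qed
  finally show False
    using d by simp
qed

text \<open>The unit normal completes each tangent frame to an orthonormal basis, so the volume is 1
  or -1; being continuous on a connected set, it is constant.\<close>

lemma orientation_sign:
  fixes \<tau> :: "'a::euclidean_space \<times> 'a \<Rightarrow> ('a \<times> 'a) list"
  assumes k: "Suc k = DIM('a \<times> 'a)" and dim: "2 \<le> DIM('a)"
    and \<tau>: "orientation k (norm_cone - {0}) \<tau>"
  obtains \<sigma> :: real where "\<bar>\<sigma>\<bar> = 1"
    and "\<And>z. z \<in> norm_cone - {0} \<Longrightarrow> vol_form (conormal z # \<tau> z) = \<sigma> * norm z"
proof -
  let ?M = "norm_cone - {0} :: ('a \<times> 'a) set"
  define u where "u z = conormal z /\<^sub>R norm z" for z :: "'a \<times> 'a"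
  define g where "g z = vol_form (u z # \<tau> z)" for z
  have frame: "orthonormal_frame k (\<tau> z)" if "z \<in> ?M" for z
    using \<tau> that by (simp add: orientation_def)
  have len: "Suc (length (\<tau> z)) = DIM('a \<times> 'a)" if "z \<in> ?M" for z
    using frame[OF that] k by (simp add: orthonormal_frame_def)
  have unit: "\<bar>g z\<bar> = 1" if z: "z \<in> ?M" for z
  proof -
    have "x \<bullet> u z = 0" if "x \<in> set (\<tau> z)" for x
    proof -
      have "x \<in> tangent_cone ?M z"
        using \<tau> z span_base[OF that] by (simp add: orientation_def)
      then show ?thesis
        using tangent_cone_norm_cone[of z x] z by (simp add: u_def)
    qed
    moreover have "norm (u z) = 1"
      using z by (simp add: u_def norm_conormal)
    ultimately have "orthonormal_frame DIM('a \<times> 'a) (u z # \<tau> z)"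
      using orthonormal_frame_Cons[OF frame[OF z], of "u z"] unfolding k by blast
    then show ?thesis
      unfolding g_def by (rule vol_form_orthonormal)
  qed
  \<comment> \<open>Continuity of the orientation, too, is available only through constant
    covectors.\<close>
  have "continuous_on ?M (\<lambda>z. \<Sum>b\<in>Basis. (u z \<bullet> b) * vol_form (b # \<tau> z))"
  proof (intro continuous_intros)
    show "continuous_on ?M u"
      unfolding u_def conormal_def by (intro continuous_intros) auto
    show "continuous_on ?M (\<lambda>z. vol_form (b # \<tau> z))" for b
      using \<tau> vol_form_Cons_covector[OF k, of b] unfolding orientation_def by blast
  qed
  then have cont: "continuous_on ?M g"
    by (rule continuous_on_eq) (simp add: g_def vol_form_Cons_expand[OF len])
  have "g ` ?M \<subseteq> {1, -1}"
    using unit by (auto simp: abs_eq_iff')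
  then have "finite (g ` ?M)"
    by (rule finite_subset) simp
  then have "g constant_on ?M"
    by (rule continuous_finite_range_constant[OF connected_norm_cone[OF dim] cont])
  then obtain \<sigma> where \<sigma>: "\<And>z. z \<in> ?M \<Longrightarrow> g z = \<sigma>"
    by (auto simp: constant_on_def)
  obtain b :: 'a where b: "b \<in> Basis"
    using nonempty_Basis by blast
  have "(b, b) \<in> ?M"
    using b nonzero_Basis[OF b] by (simp add: norm_cone_def prod_eq_iff)
  then have "\<bar>\<sigma>\<bar> = 1"
    using unit \<sigma> by metis
  moreover have "vol_form (conormal z # \<tau> z) = \<sigma> * norm z" if z: "z \<in> ?M" for z
  proof -
    have "conormal z = norm z *\<^sub>R u z"
      using z by (simp add: u_def)
    then have "vol_form (conormal z # \<tau> z) = norm z * g z"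
      using linear_scale[OF vol_form_Cons_linear[OF len[OF z]], of "norm z" "u z"] by (simp add: g_def)
    then show ?thesis
      by (simp add: \<sigma>[OF z])
  qed
  ultimately show thesis
    by (rule that)
qed

text \<open>Equality almost everywhere does not suffice, since \<open>g\<close> may be
  non-measurable. The two integrands differ by a multiple of the indicator of a measurable point, so
  they are measurable together; otherwise neither is integrable and both integrals are 0 by
  default.\<close>

lemma set_lebesgue_integral_remove_point:
  fixes g :: "'a \<Rightarrow> real"
  assumes N: "{a} \<in> null_sets M"
  shows "set_lebesgue_integral M (A - {a}) g = set_lebesgue_integral M A g"
proof -
  let ?F = "\<lambda>A x. indicator A x *\<^sub>R g x"
  have a: "{a} \<in> sets M"
    using N by auto
  have AE: "AE x in M. ?F (A - {a}) x = ?F A x"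
    using AE_not_in[OF N] by eventually_elim (simp add: indicator_def)
  have "?F (A - {a}) \<in> borel_measurable M \<longleftrightarrow> ?F A \<in> borel_measurable M"
  proof
    assume "?F (A - {a}) \<in> borel_measurable M"
    then have "(\<lambda>x. ?F (A - {a}) x + indicator {a} x * ?F A a) \<in> borel_measurable M"
      using a by measurable
    also have "(\<lambda>x. ?F (A - {a}) x + indicator {a} x * ?F A a) = ?F A"
      by (auto simp: indicator_def)
    finally show "?F A \<in> borel_measurable M" .
  next
    assume "?F A \<in> borel_measurable M"
    then have "(\<lambda>x. ?F A x - indicator {a} x * ?F A a) \<in> borel_measurable M"
      using a by measurable
    also have "(\<lambda>x. ?F A x - indicator {a} x * ?F A a) = ?F (A - {a})"
      by (auto simp: indicator_def)
    finally show "?F (A - {a}) \<in> borel_measurable M" .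
  qed
  then consider "?F (A - {a}) \<in> borel_measurable M" "?F A \<in> borel_measurable M"
    | "\<not> integrable M (?F (A - {a}))" "\<not> integrable M (?F A)"
    using borel_measurable_integrable by blast
  then show ?thesis
    unfolding set_lebesgue_integral_def
    by cases (simp_all add: integral_cong_AE[OF _ _ AE] not_integrable_integral_eq del: real_scaleR_def)
qed

text \<open>Serves to discard the apex of the cone, where the orientation is an arbitrary list and
  may fail to be an orthonormal frame.\<close>

lemma current_remove_point:
  fixes S :: "'a::euclidean_space rect_data"
  assumes "k \<ge> 1"
  shows "current k (S\<lparr>carr := carr S - {a}\<rparr>) \<omega> = current k S \<omega>"
proof -
  have "{a} \<in> sets (hausdorff k)"
    by (rule borel_in_sets_hausdorff) simp
  then have "{a} \<in> null_sets (hausdorff k)"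
    using assms by (intro null_setsI) (simp_all add: emeasure_hausdorff hausdorff_outer_singleton)
  from set_lebesgue_integral_remove_point[OF this] show ?thesis
    by (simp add: current_def)
qed

section \<open>Comparison of the weighted masses\<close>

theorem minimizing_norm_cone:
  fixes \<tau> :: "'a::euclidean_space \<times> 'a \<Rightarrow> ('a \<times> 'a) list"
  assumes k: "Suc k = DIM('a \<times> 'a)" and dim: "2 \<le> DIM('a)" and \<alpha>: "\<alpha> \<ge> 1"
    and \<tau>: "orientation k (norm_cone - {0}) \<tau>"
  shows "minimizing_cone k (\<lambda>z. norm z powr \<alpha>) norm_cone \<tau>"
  unfolding minimizing_cone_def
proof (intro allI impI)
  fix S :: "('a \<times> 'a) rect_data"
  assume S: "rectifiable_current k S"
    and bdry: "\<forall>\<phi>. test_form (k - 1) \<phi> \<longrightarrow>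
      boundary (current k S) \<phi> = boundary (current k (truncated_cone norm_cone \<tau>)) \<phi>"
  define T where "T = truncated_cone norm_cone \<tau>"
  define T' where "T' = T\<lparr>carr := carr T - {0}\<rparr>"
  define \<beta> where "\<beta> = \<alpha> - 1"
  let ?H = "hausdorff k :: ('a \<times> 'a) measure"
  have \<beta>: "\<beta> \<ge> 0" "\<beta> + 1 = \<alpha>"
    using \<alpha> by (simp_all add: \<beta>_def)
  have k1: "k \<ge> 1"
    using k dim by simp
  have T'_simps: "carr T' = norm_cone \<inter> cball 0 1 - {0}" "mult T' = (\<lambda>_. 1)" "orient T' = \<tau>"
    by (simp_all add: T'_def T_def truncated_cone_def)
  have borel: "norm_cone \<inter> cball 0 1 \<in> sets (borel :: ('a \<times> 'a) measure)"
    by (intro borel_closed closed_Int closed_norm_cone closed_cball)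
  have carr_borel: "carr T' \<in> sets borel"
    unfolding T'_simps using borel by (rule sets.Diff) simp
  have carr_sets: "carr T' \<in> sets ?H"
    using carr_borel by (rule borel_in_sets_hausdorff)
  have sub: "carr T' \<subseteq> norm_cone - {0}"
    by (auto simp: T'_simps)
  have finite_T': "finite_mass_data k T'"
    unfolding finite_mass_data_def
  proof (intro conjI allI impI ballI)
    show "carr T' \<in> sets ?H"
      by (rule carr_sets)
    show "bounded (carr T')"
      unfolding T'_simps by (rule bounded_subset[OF bounded_cball[of 0 1]]) auto
    show "set_borel_measurable ?H (carr T') (\<lambda>z. real (mult T' z))"
      using carr_sets by (simp add: set_borel_measurable_def T'_simps(2))
    have "(\<integral>\<^sup>+z\<in>carr T'. ennreal (real (mult T' z)) \<partial>?H) = emeasure ?H (carr T')"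
      using carr_sets by (simp add: T'_simps(2))
    also have "\<dots> \<le> hausdorff_outer k (norm_cone \<inter> cball 0 1 :: ('a \<times> 'a) set)"
      unfolding emeasure_hausdorff[OF carr_sets] by (rule hausdorff_outer_mono) (auto simp: T'_simps)
    also have "\<dots> < \<infinity>"
      by (rule hausdorff_outer_cone_finite) (use k in \<open>simp_all add: norm_cone_def\<close>)
    finally show "(\<integral>\<^sup>+z\<in>carr T'. ennreal (real (mult T' z)) \<partial>?H) < \<infinity>" .
    show "orthonormal_frame k (orient T' z)" if "z \<in> carr T'" for z
      using \<tau> that sub by (auto simp: orientation_def T'_simps(3))
    fix \<phi> :: "('a \<times> 'a) list \<Rightarrow> real"
    assume "covector k \<phi>"
    then have "continuous_on (norm_cone - {0}) (\<lambda>z. \<phi> (\<tau> z))"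
      using \<tau> by (simp add: orientation_def)
    then have "continuous_on (carr T') (\<lambda>z. \<phi> (orient T' z))"
      unfolding T'_simps(3) using sub by (rule continuous_on_subset)
    then show "set_borel_measurable ?H (carr T') (\<lambda>z. \<phi> (orient T' z))"
      unfolding set_borel_measurable_def
      by (intro borel_measurable_hausdorff borel_measurable_continuous_on_indicator carr_borel)
  qed
  have finite_S: "finite_mass_data k S"
    using S by (simp add: finite_mass_data_def rectifiable_current_def)
  have "current k T' = current k T"
    by (simp add: T'_def fun_eq_iff current_remove_point[OF k1])
  then have flux_eq: "flux k \<beta> S = flux k \<beta> T'"
    using bdry by (intro flux_eqI[OF k \<beta>(1) finite_S finite_T']) (simp add: T_def)
  obtain \<sigma> :: real where \<sigma>: "\<bar>\<sigma>\<bar> = 1"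
    "\<And>z. z \<in> norm_cone - {0} \<Longrightarrow> vol_form (conormal z # \<tau> z) = \<sigma> * norm z"
    using orientation_sign[OF k dim \<tau>] by blast
  have val: "vol_form (calib \<beta> ((norm z)\<^sup>2) z # \<tau> z) = \<sigma> * norm z powr \<alpha>" if z: "z \<in> carr T'" for z
  proof -
    have zM: "z \<in> norm_cone - {0}"
      using z sub by blast
    have "Suc (length (\<tau> z)) = DIM('a \<times> 'a)"
      using \<tau> zM k by (simp add: orientation_def orthonormal_frame_def)
    from linear_scale[OF vol_form_Cons_linear[OF this], of "norm z powr \<beta>" "conormal z"]
    have "vol_form (calib \<beta> ((norm z)\<^sup>2) z # \<tau> z) = norm z powr \<beta> * (\<sigma> * norm z)"
      using zM \<sigma>(2)[OF zM] calib_cone[OF \<beta>(1), of z] by (simp add: norm_cone_def conormal_def)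
    also have "\<dots> = \<sigma> * norm z powr (\<beta> + 1)"
      using zM by (simp add: powr_add)
    finally show ?thesis
      by (simp add: \<beta>(2))
  qed
  let ?w = "\<lambda>z. indicator (carr T') z *\<^sub>R norm z powr \<alpha>"
  let ?v = "\<lambda>z. indicator (carr T') z *\<^sub>R (real (mult T' z) * vol_form (calib \<beta> ((norm z)\<^sup>2) z # orient T' z))"
  have v_eq: "?v z = \<sigma> * ?w z" for z
    using val[of z] by (cases "z \<in> carr T'") (simp_all add: T'_simps(2,3))
  have int_v: "integrable ?H ?v"
    using flux_limit(1)[OF k \<beta>(1) finite_T'] by (simp add: set_integrable_def)
  \<comment> \<open>Solving for the weight transfers integrability from the calibrating form to the
    weight.\<close>
  have "\<sigma> * \<sigma> = 1"
    using \<sigma>(1) by (metis abs_mult_self_eq mult_1)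
  then have w_eq: "?w z = \<sigma> * ?v z" for z
    unfolding v_eq by (simp add: mult.assoc[symmetric])
  have int_w: "integrable ?H ?w"
    unfolding w_eq by (intro integrable_mult_right int_v)
  have "flux k \<beta> T' = integral\<^sup>L ?H ?v"
    by (simp add: flux_def current_def set_lebesgue_integral_def)
  also have "\<dots> = \<sigma> * integral\<^sup>L ?H ?w"
    unfolding v_eq by simp
  finally have "\<bar>flux k \<beta> T'\<bar> = integral\<^sup>L ?H ?w"
    using \<sigma>(1) by (simp add: abs_mult integral_nonneg_AE)
  \<comment> \<open>Here the apex is back in the carrier; its weight is
    \<open>0 powr \<alpha> = 0\<close>, so the integrands agree at every point.\<close>
  moreover have "weighted_mass k (\<lambda>z. norm z powr \<alpha>) T = (\<integral>\<^sup>+z. ennreal (?w z) \<partial>?H)"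
    unfolding weighted_mass_def
    by (rule nn_integral_cong) (auto simp: T'_simps T_def truncated_cone_def indicator_def)
  moreover have "\<dots> = ennreal (integral\<^sup>L ?H ?w)"
    by (rule nn_integral_eq_integral[OF int_w]) simp
  ultimately have "weighted_mass k (\<lambda>z. norm z powr \<alpha>) T = ennreal \<bar>flux k \<beta> S\<bar>"
    by (simp add: flux_eq)
  also have "\<dots> \<le> weighted_mass k (\<lambda>z. norm z powr \<alpha>) S"
    using flux_le_weighted_mass[OF k \<beta>(1) finite_S] by (simp add: \<beta>(2))
  finally show "weighted_mass k (\<lambda>z. norm z powr \<alpha>) (truncated_cone norm_cone \<tau>)
      \<le> weighted_mass k (\<lambda>z. norm z powr \<alpha>) S"
    by (simp add: T_def)
qed

lemma simons_cone_eq: "simons_cone = norm_cone"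
  by (auto simp: simons_cone_def norm_cone_def norm_vec_def L2_set_def)

theorem corollary1p13:
  fixes p :: nat and \<alpha> :: real
    and \<tau> :: "(real ^ 'n) \<times> (real ^ 'n) \<Rightarrow> ((real ^ 'n) \<times> (real ^ 'n)) list"
  assumes "p \<ge> 1" and "CARD('n::finite) = p + 1" and "\<alpha> \<ge> 1"
    and "orientation (2 * p + 1) (simons_cone - {0}) \<tau>"
  shows "minimizing_cone (2 * p + 1) (\<lambda>x. norm x powr \<alpha>) simons_cone \<tau>"
  using assms unfolding simons_cone_eq by (intro minimizing_norm_cone) simp_all

end
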